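(* Suppose that $F$ has a minimizer $x_*\in\mathbb{R}^d$, that $F$ is $L$-smooth and that $\{f_{i,p}\}$ has $\mathcal{V}$-bounded variance. Consider S-SGD-EF with constant step size $\eta_t=\eta$ and with $\gamma=\Theta(k/d)$ sufficiently small. Then, for every $\varepsilon>0$, with an appropriate choice of $\eta>0$, the number $T$ of iterations of S-SGD-EF to achieve $\mathbb{E}\|\nabla F(x_{\mathrm{out}})\|^2\le\varepsilon$ is $$O\left(\frac{L\Delta}{\varepsilon}+\frac{\mathcal{V}}{P}\frac{L\Delta}{\varepsilon^2}+\frac dk+\frac{d}{k\sqrt P}\left(\frac{L\Delta}{\varepsilon}+\frac{L\sqrt{\mathcal{V}}\Delta}{\varepsilon^{3/2}}\right)\right),$$ where $\Delta=F(x_{\mathrm{in}})-F(x_* )$, $x_{\mathrm{out}}=x_{\hat t-1}$ and $\hat t$ is drawn uniformly at random from $[T]$.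
   Context: Problem. $d,N,P$ are positive integers, $[m]=\{1,\dots,m\}$, $\|\cdot\|$ is the Euclidean norm, $f_{i,p}:\mathbb{R}^d\to\mathbb{R}$ ($i\in[N]$, $p\in[P]$) are differentiable (not necessarily convex), and $F(x)=\frac1P\sum_{p=1}^P\frac1N\sum_{i=1}^N f_{i,p}(x)$. Assumptions. $F$ is $L$-smooth ($L>0$): $\|\nabla F(x)-\nabla F(y)\|\le L\|x-y\|$ for all $x,y$. $\mathcal{V}$-bounded variance: $\frac1{NP}\sum_{i,p}\|\nabla f_{i,p}(x)-\nabla F(x)\|^2\le\mathcal{V}$ for all $x$. Random compression. For $x\in\mathbb{R}^d$ and an integer $1\le k\le d$, $\mathrm{RandComp}(x,k)$ is the random vector obtained by drawing a subset $J\subset[d]$ uniformly among all subsets with $k$ elements (independently at each call) and setting the $j$-th coordinate to $(d/k)x_j$ if $j\in J$ and to $0$ otherwise. S-SGD-EF. Inputs: $x_{\mathrm{in}}\in\mathbb{R}^d$, step sizes $\eta_t>0$, $\gamma>0$, $k\in[d]$, $T$. Set $x_0=x_{\mathrm{in}}$, $m_{0,p}=0$ for $p\in[P]$. For $t=1,\dots,T$: for each $p$ draw $i_{t,p}$ uniformly from $[N]$ (independently over $t,p$); put $g_{t,p}=\nabla f_{i_{t,p},p}(x_{t-1})+\frac{\gamma}{\eta_t}m_{t-1,p}$, $\bar g_{t,p}=\mathrm{RandComp}(g_{t,p},k)$, $m_{t,p}=m_{t-1,p}+\eta_t(\nabla f_{i_{t,p},p}(x_{t-1})-\bar g_{t,p})$;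 then $x_t=x_{t-1}-\eta_t\frac1P\sum_{p=1}^P\bar g_{t,p}$. Conventions. "$\gamma=\Theta(k/d)$ sufficiently small" means $\gamma=c\,k/d$ with $c>0$ a sufficiently small absolute constant. $O$ hides absolute constants. *)

theory Defs
  imports
    "HOL-Probability.Probability"
    "HOL-Analysis.Abstract_Euclidean_Space"
begin

text \<open>
  The dimension \<open>d\<close> is quantified inside the formula, after the absolute constants, so it cannot be a
  type. Vectors of \<open>\<real>\<^sup>d\<close> are functions \<open>nat \<Rightarrow> real\<close> that vanish from index \<open>d\<close> on, as in
  \<open>topspace_Euclidean_space\<close>; coordinates are numbered from \<open>0\<close> to \<open>d - 1\<close>.
\<close>

type_synonym vec = "nat \<Rightarrow> real"

abbreviation Rd :: "nat \<Rightarrow> vec set" where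
  "Rd d \<equiv> topspace (Euclidean_space d)"

abbreviation enorm :: "nat \<Rightarrow> vec \<Rightarrow> real" where
  "enorm d x \<equiv> L2_set x {..<d}"

text \<open>Frechet differentiability at \<open>x\<close> with gradient \<open>g\<close>. Only the values of \<open>f\<close> on \<open>Rd d\<close> matter.\<close>

definition has_grad :: "nat \<Rightarrow> (vec \<Rightarrow> real) \<Rightarrow> vec \<Rightarrow> vec \<Rightarrow> bool" where
  "has_grad d f g x \<longleftrightarrow> g \<in> Rd d \<and>
     (\<forall>e>0. \<exists>\<delta>>0. \<forall>y\<in>Rd d. enorm d (\<lambda>j. y j - x j) < \<delta> \<longrightarrow>
        \<bar>f y - f x - (\<Sum>j<d. g j * (y j - x j))\<bar> \<le> e * enorm d (\<lambda>j. y j - x j))"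

definition differentiable_Rd :: "nat \<Rightarrow> (vec \<Rightarrow> real) \<Rightarrow> bool" where
  "differentiable_Rd d f \<longleftrightarrow> (\<forall>x\<in>Rd d. \<exists>g. has_grad d f g x)"

definition grad :: "nat \<Rightarrow> (vec \<Rightarrow> real) \<Rightarrow> vec \<Rightarrow> vec" where
  "grad d f x = (THE g. has_grad d f g x)"

lemma has_grad_unique:
  assumes g: "has_grad d f g x" and h: "has_grad d f h x" and x: "x \<in> Rd d"
  shows "g = h"
proof
  fix j
  show "g j = h j"
  proof (cases "j < d")
    case False
    then show ?thesis
      using g h by (auto simp: has_grad_def topspace_Euclidean_space)
  next
    case True
    have bound: "\<bar>g j - h j\<bar> \<le> 2 * e" if e: "e > 0" for e :: real
    proof -
      obtain \<delta>1 where \<delta>1: "\<delta>1 > 0"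
        "\<And>y. y \<in> Rd d \<Longrightarrow> enorm d (\<lambda>j. y j - x j) < \<delta>1 \<Longrightarrow>
          \<bar>f y - f x - (\<Sum>j<d. g j * (y j - x j))\<bar> \<le> e * enorm d (\<lambda>j. y j - x j)"
        using g e unfolding has_grad_def by meson
      obtain \<delta>2 where \<delta>2: "\<delta>2 > 0"
        "\<And>y. y \<in> Rd d \<Longrightarrow> enorm d (\<lambda>j. y j - x j) < \<delta>2 \<Longrightarrow>
          \<bar>f y - f x - (\<Sum>j<d. h j * (y j - x j))\<bar> \<le> e * enorm d (\<lambda>j. y j - x j)"
        using h e unfolding has_grad_def by meson
      define s where "s = min \<delta>1 \<delta>2 / 2"
      have s: "s > 0" "s < \<delta>1" "s < \<delta>2"
        using \<delta>1(1) \<delta>2(1) by (auto simp: s_def min_def)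
      define y where "y = x(j := x j + s)"
      have diff: "y i - x i = (if i = j then s else 0)" for i
        by (simp add: y_def)
      have y: "y \<in> Rd d"
        using x True by (auto simp: y_def topspace_Euclidean_space)
      have norm: "enorm d (\<lambda>i. y i - x i) = s"
        using True s(1) by (simp add: diff L2_set_def if_distrib[of "\<lambda>x. x ^ 2"] sum.delta cong: if_cong)
      have sums: "(\<Sum>i<d. k i * (y i - x i)) = k j * s" for k :: vec
        using True by (simp add: diff if_distrib[of "\<lambda>x. _ * x"] sum.delta cong: if_cong)
      have "\<bar>f y - f x - g j * s\<bar> \<le> e * s" "\<bar>f y - f x - h j * s\<bar> \<le> e * s"
        using \<delta>1(2)[OF y] \<delta>2(2)[OF y] s by (simp_all add: norm sums)
      then have "\<bar>g j * s - h j * s\<bar> \<le> 2 * e * s"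
        by linarith
      then have "\<bar>g j - h j\<bar> * s \<le> 2 * e * s"
        using s(1) by (simp add: abs_mult left_diff_distrib[symmetric])
      then show ?thesis
        using s(1) by (rule mult_right_le_imp_le)
    qed
    show ?thesis
    proof (rule ccontr)
      assume "g j \<noteq> h j"
      then show False
        using bound[of "\<bar>g j - h j\<bar> / 4"] by simp
    qed
  qed
qed

lemma grad_eq: "has_grad d f g x \<Longrightarrow> x \<in> Rd d \<Longrightarrow> grad d f x = g"
  unfolding grad_def by (blast intro: has_grad_unique)

definition objective :: "nat \<Rightarrow> nat \<Rightarrow> (nat \<Rightarrow> nat \<Rightarrow> vec \<Rightarrow> real) \<Rightarrow> vec \<Rightarrow> real" where
  "objective N P f x = 1 / real P * (\<Sum>p=1..P. 1 / real N * (\<Sum>i=1..N. f i p x))"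

definition smooth_Rd :: "nat \<Rightarrow> real \<Rightarrow> (vec \<Rightarrow> real) \<Rightarrow> bool" where
  "smooth_Rd d L F \<longleftrightarrow> (\<forall>x\<in>Rd d. \<forall>y\<in>Rd d.
     enorm d (\<lambda>j. grad d F x j - grad d F y j) \<le> L * enorm d (\<lambda>j. x j - y j))"

definition bounded_variance ::
  "nat \<Rightarrow> nat \<Rightarrow> nat \<Rightarrow> real \<Rightarrow> (nat \<Rightarrow> nat \<Rightarrow> vec \<Rightarrow> real) \<Rightarrow> bool" where
  "bounded_variance d N P V f \<longleftrightarrow> (\<forall>x\<in>Rd d.
     1 / (real N * real P) * (\<Sum>i=1..N. \<Sum>p=1..P.
       (enorm d (\<lambda>j. grad d (f i p) x j - grad d (objective N P f) x j))\<^sup>2) \<le> V)"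

definition rand_comp :: "nat \<Rightarrow> nat \<Rightarrow> vec \<Rightarrow> vec pmf" where
  "rand_comp d k x =
     map_pmf (\<lambda>J j. if j \<in> J then real d / real k * x j else 0)
       (pmf_of_set {J. J \<subseteq> {..<d} \<and> card J = k})"

text \<open>
  A state is the current iterate \<open>x\<close> with the memories \<open>m p\<close>, \<open>p \<in> {1..P}\<close>. One iteration with step
  size \<open>\<eta>\<close>: the product distributions \<open>Pi_pmf\<close> make the draws independent over the workers \<open>p\<close>
  (the values at \<open>p \<notin> {1..P}\<close> are never used), and the monadic bind draws afresh at each iteration.
\<close>

definition ssgd_ef_step ::
  "nat \<Rightarrow> nat \<Rightarrow> nat \<Rightarrow> nat \<Rightarrow> (nat \<Rightarrow> nat \<Rightarrow> vec \<Rightarrow> real) \<Rightarrow> real \<Rightarrow> real \<Rightarrow>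
    vec \<times> (nat \<Rightarrow> vec) \<Rightarrow> (vec \<times> (nat \<Rightarrow> vec)) pmf" where
  "ssgd_ef_step d N P k f \<gamma> \<eta> = (\<lambda>(x, m). do {
     i \<leftarrow> Pi_pmf {1..P} 0 (\<lambda>_. pmf_of_set {1..N});
     let v = (\<lambda>p. grad d (f (i p) p) x);
     let g = (\<lambda>p j. v p j + \<gamma> / \<eta> * m p j);
     gbar \<leftarrow> Pi_pmf {1..P} (\<lambda>_. 0) (\<lambda>p. rand_comp d k (g p));
     return_pmf
       (\<lambda>j. x j - \<eta> * (1 / real P * (\<Sum>p=1..P. gbar p j)),
        \<lambda>p j. m p j + \<eta> * (v p j - gbar p j))
   })"

fun ssgd_ef ::
  "nat \<Rightarrow> nat \<Rightarrow> nat \<Rightarrow> nat \<Rightarrow> (nat \<Rightarrow> nat \<Rightarrow> vec \<Rightarrow> real) \<Rightarrow> real \<Rightarrow> (nat \<Rightarrow> real) \<Rightarrow> vec \<Rightarrow> nat \<Rightarrow>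
    (vec \<times> (nat \<Rightarrow> vec)) pmf" where
  "ssgd_ef d N P k f \<gamma> \<eta> xin 0 = return_pmf (xin, \<lambda>_ _. 0)"
| "ssgd_ef d N P k f \<gamma> \<eta> xin (Suc t) =
     bind_pmf (ssgd_ef d N P k f \<gamma> \<eta> xin t) (ssgd_ef_step d N P k f \<gamma> (\<eta> (Suc t)))"

text \<open>
  The law of \<open>x\<^sub>o\<^sub>u\<^sub>t\<close>. The random index is independent of the run, so only the law of each single iterate
  enters.
\<close>

definition ssgd_ef_out ::
  "nat \<Rightarrow> nat \<Rightarrow> nat \<Rightarrow> nat \<Rightarrow> (nat \<Rightarrow> nat \<Rightarrow> vec \<Rightarrow> real) \<Rightarrow> real \<Rightarrow> (nat \<Rightarrow> real) \<Rightarrow> vec \<Rightarrow> nat \<Rightarrow>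
    vec pmf" where
  "ssgd_ef_out d N P k f \<gamma> \<eta> xin T = do {
     that \<leftarrow> pmf_of_set {1..T};
     map_pmf fst (ssgd_ef d N P k f \<gamma> \<eta> xin (that - 1))
   }"

end

theory Submission
  imports Defs
begin

text \<open>
  Write \<open>v\<^sub>t\<close> for the mean over the workers of the stochastic gradients at \<open>x\<^sub>t\<close> and \<open>\<mu>\<^sub>t\<close> for the mean of
  the memories. The virtual iterate \<open>z\<^sub>t = x\<^sub>t - \<mu>\<^sub>t\<close> performs uncompressed SGD steps,
  \<open>z\<^sub>t\<^sub>+\<^sub>1 = z\<^sub>t - \<eta> v\<^sub>t\<close>, so the descent lemma along \<open>z\<close> leaves only the error
  \<open>\<eta> L\<^sup>2 / 2\<close> times the squared norm of \<open>\<mu>\<^sub>t\<close>. Each memory is contracted by \<open>1 - \<gamma>\<close> and receives the centered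
  compression error, of variance at most \<open>d / k\<close> times the squared norm of \<open>g\<^sub>t\<^sub>,\<^sub>p\<close>. Independence of the workers makes
  the second moment of \<open>\<mu>\<^sub>t\<close> exactly \<open>1 / P\<close> times the mean second moment of the memories.
  Adding a multiple of the memories to \<open>F(z)\<close> gives a potential that decreases by \<open>\<eta> / 8\<close> times the
  squared gradient norm, up to noise.
\<close>

section \<open>Finitely supported distributions\<close>

text \<open>Every distribution in the algorithm has finite support, so integrability is automatic.
  The lemmas of this group record linearity, monotonicity and iterated expectation without
  integrability side conditions.\<close>

lemma expectation_add_finite:
  fixes f g :: "'a \<Rightarrow> real"
  assumes "finite (set_pmf p)"
  shows "measure_pmf.expectation p (\<lambda>x. f x + g x) =
    measure_pmf.expectation p f + measure_pmf.expectation p g"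
  using assms by (intro Bochner_Integration.integral_add integrable_measure_pmf_finite)

lemma expectation_diff_finite:
  fixes f g :: "'a \<Rightarrow> real"
  assumes "finite (set_pmf p)"
  shows "measure_pmf.expectation p (\<lambda>x. f x - g x) =
    measure_pmf.expectation p f - measure_pmf.expectation p g"
  using assms by (intro Bochner_Integration.integral_diff integrable_measure_pmf_finite)

lemma expectation_sum_finite:
  fixes f :: "'b \<Rightarrow> 'a \<Rightarrow> real"
  assumes "finite (set_pmf p)"
  shows "measure_pmf.expectation p (\<lambda>x. \<Sum>b\<in>B. f b x) = (\<Sum>b\<in>B. measure_pmf.expectation p (f b))"
  using assms by (intro Bochner_Integration.integral_sum integrable_measure_pmf_finite)

lemma expectation_mono_finite:
  fixes f g :: "'a \<Rightarrow> real"
  assumes "finite (set_pmf p)" "\<And>x. x \<in> set_pmf p \<Longrightarrow> f x \<le> g x"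
  shows "measure_pmf.expectation p f \<le> measure_pmf.expectation p g"
  using assms by (intro integral_mono_AE integrable_measure_pmf_finite) (auto simp: AE_measure_pmf_iff)

lemma expectation_cong_finite:
  fixes f g :: "'a \<Rightarrow> real"
  assumes "\<And>x. x \<in> set_pmf p \<Longrightarrow> f x = g x"
  shows "measure_pmf.expectation p f = measure_pmf.expectation p g"
  using assms by (intro integral_cong_AE) (auto simp: AE_measure_pmf_iff)

lemma expectation_bind_finite:
  fixes h :: "'b \<Rightarrow> real"
  assumes "finite (set_pmf p)" "\<And>x. x \<in> set_pmf p \<Longrightarrow> finite (set_pmf (f x))"
  shows "measure_pmf.expectation (bind_pmf p f) h =
    measure_pmf.expectation p (\<lambda>x. measure_pmf.expectation (f x) h)"
  by (subst pmf_expectation_bind[OF assms order_refl]) (auto simp: integral_measure_pmf[OF assms(1)])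

lemma finite_set_Pi_pmf:
  assumes "finite A" "\<And>a. a \<in> A \<Longrightarrow> finite (set_pmf (M a))"
  shows "finite (set_pmf (Pi_pmf A dflt M))"
  using assms by (subst set_Pi_pmf) auto

lemma expectation_Pi_pmf_component:
  fixes h :: "'b \<Rightarrow> real"
  assumes "finite A" "a \<in> A"
  shows "measure_pmf.expectation (Pi_pmf A dflt M) (\<lambda>y. h (y a)) = measure_pmf.expectation (M a) h"
proof -
  have "measure_pmf.expectation (M a) h =
      measure_pmf.expectation (map_pmf (\<lambda>y. y a) (Pi_pmf A dflt M)) h"
    using assms by (simp add: Pi_pmf_component)
  then show ?thesis by simp
qed

text \<open>Independence and zero means kill the cross terms, so variances add. The offset
  \<open>a\<close> is generalized in the induction: conditioning on the coordinate \<open>c\<close>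
  makes \<open>h c y\<close> part of the offset for the remaining set.\<close>

lemma second_moment_centered_sum_Pi_pmf:
  fixes h :: "'a \<Rightarrow> 'b \<Rightarrow> real"
  assumes "finite A" "\<And>b. b \<in> A \<Longrightarrow> finite (set_pmf (M b))"
    and "\<And>b. b \<in> A \<Longrightarrow> measure_pmf.expectation (M b) (h b) = 0"
  shows "measure_pmf.expectation (Pi_pmf A dflt M) (\<lambda>y. (a + (\<Sum>b\<in>A. h b (y b)))\<^sup>2) =
    a\<^sup>2 + (\<Sum>b\<in>A. measure_pmf.expectation (M b) (\<lambda>u. (h b u)\<^sup>2))"
  using assms
proof (induction A arbitrary: a rule: finite_induct)
  case empty
  then show ?case by simp
next
  case (insert c A)
  have fin: "finite (set_pmf (M c))" "finite (set_pmf (Pi_pmf A dflt M))"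
    using insert by (auto intro!: finite_set_Pi_pmf)
  have upd: "(\<Sum>b\<in>A. h b ((f(c := y)) b)) = (\<Sum>b\<in>A. h b (f b))" for f y
    using insert(2) by (intro sum.cong) auto
  let ?S = "\<Sum>b\<in>A. measure_pmf.expectation (M b) (\<lambda>u. (h b u)\<^sup>2)"
  have "measure_pmf.expectation (Pi_pmf (insert c A) dflt M)
      (\<lambda>y. (a + (\<Sum>b\<in>insert c A. h b (y b)))\<^sup>2) =
    measure_pmf.expectation (M c) (\<lambda>y. measure_pmf.expectation (Pi_pmf A dflt M)
      (\<lambda>f. ((a + h c y) + (\<Sum>b\<in>A. h b (f b)))\<^sup>2))"
    using insert(1,2) fin
    by (simp add: Pi_pmf_insert' expectation_bind_finite upd algebra_simps
        del: fun_upd_apply) (simp add: add_ac)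
  also have "\<dots> = measure_pmf.expectation (M c) (\<lambda>y. a\<^sup>2 + (h c y)\<^sup>2 + 2 * a * h c y + ?S)"
    using insert.prems by (subst insert.IH) (simp_all add: power2_sum)
  also have "\<dots> = a\<^sup>2 + measure_pmf.expectation (M c) (\<lambda>u. (h c u)\<^sup>2) + ?S"
    using fin insert.prems(2)[of c] by (simp add: expectation_add_finite)
  finally show ?case
    using insert(1,2) by simp
qed

section \<open>Random compression\<close>

text \<open>In probabilistic terms, a uniform \<open>k\<close>-subset contains \<open>j\<close> with
  probability \<open>k / d\<close>. Removing the subsets that avoid \<open>j\<close> leaves
  \<open>d' choose k'\<close> by Pascal's rule, and the absorption identity finishes.\<close>

lemma card_subsets_containing:
  assumes "j < d" "1 \<le> k"
  shows "d * card {J. J \<subseteq> {..<d} \<and> card J = k \<and> j \<in> J} = k * (d choose k)"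
proof -
  obtain d' k' where dk: "d = Suc d'" "k = Suc k'"
    using assms by (cases d; cases k) auto
  let ?A = "{J. J \<subseteq> {..<d} \<and> card J = k}"
  let ?B = "{J. J \<subseteq> {..<d} - {j} \<and> card J = k}"
  have eq: "{J. J \<subseteq> {..<d} \<and> card J = k \<and> j \<in> J} = ?A - ?B" by auto
  have "card (?A - ?B) = card ?A - card ?B"
    by (intro card_Diff_subset) (auto intro: finite_subset[of _ "Pow {..<d}"])
  also have "\<dots> = (d choose k) - (d' choose k)"
    using assms by (simp add: n_subsets dk)
  also have "\<dots> = d' choose k'" by (simp add: dk)
  finally show ?thesis
    unfolding eq unfolding dk by (metis Suc_times_binomial_eq mult.commute)
qed

lemma
  assumes k: "1 \<le> k" "k \<le> d"
  shows finite_set_rand_comp: "finite (set_pmf (rand_comp d k x))"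
    and expectation_rand_comp: "j < d \<Longrightarrow> measure_pmf.expectation (rand_comp d k x) (\<lambda>y. y j) = x j"
    and second_moment_rand_comp: "j < d \<Longrightarrow>
      measure_pmf.expectation (rand_comp d k x) (\<lambda>y. (y j)\<^sup>2) = real d / real k * (x j)\<^sup>2"
proof -
  let ?A = "{J. J \<subseteq> {..<d} \<and> card J = k}"
  have fin: "finite ?A" by (auto intro: finite_subset[of _ "Pow {..<d}"])
  have card: "card ?A = d choose k" by (simp add: n_subsets)
  have ne: "?A \<noteq> {}" using card k by (metis binomial_eq_0_iff card.empty not_le)
  show "finite (set_pmf (rand_comp d k x))"
    using fin ne by (simp add: rand_comp_def)
  \<comment> \<open>A coordinate survives with probability \<open>k / d\<close> and is otherwise set
    to zero, where \<open>h\<close> vanishes. The identity and the square are the two instances used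
    below.\<close>
  have *: "measure_pmf.expectation (rand_comp d k x) (\<lambda>y. h (y j)) = real k / real d * h (real d / real k * x j)"
    if j: "j < d" and h: "h 0 = 0" for h :: "real \<Rightarrow> real"
  proof -
    define B where "B = {J. J \<subseteq> {..<d} \<and> card J = k \<and> j \<in> J}"
    define a where "a = h (real d / real k * x j)"
    have "measure_pmf.expectation (rand_comp d k x) (\<lambda>y. h (y j)) =
        (\<Sum>J\<in>?A. h (if j \<in> J then real d / real k * x j else 0)) / card ?A"
      using fin ne by (simp add: rand_comp_def integral_pmf_of_set)
    also have "(\<Sum>J\<in>?A. h (if j \<in> J then real d / real k * x j else 0)) = (\<Sum>J\<in>B. a)"
      unfolding B_def a_def using fin h by (intro sum.mono_neutral_cong_right) auto
    also have "\<dots> = card B * a"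
      by simp
    finally have eq: "measure_pmf.expectation (rand_comp d k x) (\<lambda>y. h (y j)) = card B * a / (d choose k)"
      unfolding card .
    have "d * card B = k * (d choose k)"
      unfolding B_def by (rule card_subsets_containing[OF j k(1)])
    then have "real d * card B = real k * (d choose k)"
      by (metis of_nat_mult)
    then have "card B = real k * (d choose k) / real d"
      using j by (metis mult.commute nonzero_mult_div_cancel_left of_nat_eq_0_iff not_less_zero)
    moreover have "real (d choose k) \<noteq> 0" using k by simp
    ultimately have "card B * a / (d choose k) = real k / real d * a"
      by simp
    then show ?thesis unfolding eq a_def .
  qed
  show "measure_pmf.expectation (rand_comp d k x) (\<lambda>y. y j) = x j" if "j < d"
  proof -
    have "measure_pmf.expectation (rand_comp d k x) (\<lambda>y. y j) = real k / real d * (real d / real k * x j)"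
      by (rule *[OF that]) simp
    also have "\<dots> = x j" using k by simp
    finally show ?thesis .
  qed
  show "measure_pmf.expectation (rand_comp d k x) (\<lambda>y. (y j)\<^sup>2) = real d / real k * (x j)\<^sup>2" if "j < d"
  proof -
    have "measure_pmf.expectation (rand_comp d k x) (\<lambda>y. (y j)\<^sup>2) = real k / real d * (real d / real k * x j)\<^sup>2"
      by (rule *[OF that]) simp
    also have "\<dots> = real d / real k * (x j)\<^sup>2" using k by (simp add: power2_eq_square)
    finally show ?thesis .
  qed
qed

section \<open>Gradients\<close>

lemma enorm_sq: "(enorm d x)\<^sup>2 = (\<Sum>j<d. (x j)\<^sup>2)"
  by (simp add: L2_set_def sum_nonneg)

lemma has_grad_cmult:
  assumes "has_grad d f g x"
  shows "has_grad d (\<lambda>y. a * f y) (\<lambda>j. a * g j) x"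
  unfolding has_grad_def
proof (intro conjI allI impI)
  show "(\<lambda>j. a * g j) \<in> Rd d"
    using assms by (auto simp: has_grad_def topspace_Euclidean_space)
  fix e :: real assume e: "e > 0"
  \<comment> \<open>The summand \<open>1\<close> keeps \<open>e'\<close> positive also for
    \<open>a = 0\<close>.\<close>
  define e' where "e' = e / (\<bar>a\<bar> + 1)"
  have e': "e' > 0" using e by (simp add: e'_def add_nonneg_pos)
  then obtain \<delta> where \<delta>: "\<delta> > 0" "\<And>y. y \<in> Rd d \<Longrightarrow> enorm d (\<lambda>j. y j - x j) < \<delta> \<Longrightarrow>
      \<bar>f y - f x - (\<Sum>j<d. g j * (y j - x j))\<bar> \<le> e' * enorm d (\<lambda>j. y j - x j)"
    using assms unfolding has_grad_def by meson
  have ae: "\<bar>a\<bar> * e' \<le> e"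
    using e by (simp add: e'_def field_simps)
  have "\<bar>a * f y - a * f x - (\<Sum>j<d. a * g j * (y j - x j))\<bar> \<le> e * enorm d (\<lambda>j. y j - x j)"
    if "y \<in> Rd d" "enorm d (\<lambda>j. y j - x j) < \<delta>" for y
  proof -
    have "\<bar>a * f y - a * f x - (\<Sum>j<d. a * g j * (y j - x j))\<bar> =
        \<bar>a\<bar> * \<bar>f y - f x - (\<Sum>j<d. g j * (y j - x j))\<bar>"
      by (simp add: abs_mult[symmetric] right_diff_distrib sum_distrib_left mult.assoc)
    also have "\<dots> \<le> \<bar>a\<bar> * (e' * enorm d (\<lambda>j. y j - x j))"
      using \<delta>(2)[OF that] by (intro mult_left_mono) auto
    also have "\<dots> = (\<bar>a\<bar> * e') * enorm d (\<lambda>j. y j - x j)" by simp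
    also have "\<dots> \<le> e * enorm d (\<lambda>j. y j - x j)"
      using ae by (intro mult_right_mono) auto
    finally show ?thesis .
  qed
  then show "\<exists>\<delta>>0. \<forall>y\<in>Rd d. enorm d (\<lambda>j. y j - x j) < \<delta> \<longrightarrow>
        \<bar>a * f y - a * f x - (\<Sum>j<d. a * g j * (y j - x j))\<bar> \<le> e * enorm d (\<lambda>j. y j - x j)"
    using \<delta>(1) by blast
qed

lemma has_grad_add:
  assumes "has_grad d f1 g1 x" "has_grad d f2 g2 x"
  shows "has_grad d (\<lambda>y. f1 y + f2 y) (\<lambda>j. g1 j + g2 j) x"
  unfolding has_grad_def
proof (intro conjI allI impI)
  show "(\<lambda>j. g1 j + g2 j) \<in> Rd d"
    using assms by (auto simp: has_grad_def topspace_Euclidean_space)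
  fix e :: real assume e: "e > 0"
  then have e2: "e / 2 > 0" by simp
  obtain \<delta>1 where \<delta>1: "\<delta>1 > 0" "\<And>y. y \<in> Rd d \<Longrightarrow> enorm d (\<lambda>j. y j - x j) < \<delta>1 \<Longrightarrow>
      \<bar>f1 y - f1 x - (\<Sum>j<d. g1 j * (y j - x j))\<bar> \<le> e / 2 * enorm d (\<lambda>j. y j - x j)"
    using assms(1) e2 unfolding has_grad_def by meson
  obtain \<delta>2 where \<delta>2: "\<delta>2 > 0" "\<And>y. y \<in> Rd d \<Longrightarrow> enorm d (\<lambda>j. y j - x j) < \<delta>2 \<Longrightarrow>
      \<bar>f2 y - f2 x - (\<Sum>j<d. g2 j * (y j - x j))\<bar> \<le> e / 2 * enorm d (\<lambda>j. y j - x j)"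
    using assms(2) e2 unfolding has_grad_def by meson
  have "\<bar>f1 y + f2 y - (f1 x + f2 x) - (\<Sum>j<d. (g1 j + g2 j) * (y j - x j))\<bar>
      \<le> e * enorm d (\<lambda>j. y j - x j)"
    if "y \<in> Rd d" "enorm d (\<lambda>j. y j - x j) < min \<delta>1 \<delta>2" for y
  proof -
    let ?A = "f1 y - f1 x - (\<Sum>j<d. g1 j * (y j - x j))"
    let ?B = "f2 y - f2 x - (\<Sum>j<d. g2 j * (y j - x j))"
    have "\<bar>?A\<bar> \<le> e / 2 * enorm d (\<lambda>j. y j - x j)" "\<bar>?B\<bar> \<le> e / 2 * enorm d (\<lambda>j. y j - x j)"
      using \<delta>1(2) \<delta>2(2) that by auto
    then have "\<bar>?A + ?B\<bar> \<le> e * enorm d (\<lambda>j. y j - x j)"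
      using abs_triangle_ineq[of ?A ?B] by (simp add: mult_ac)
    moreover have "?A + ?B = f1 y + f2 y - (f1 x + f2 x) - (\<Sum>j<d. (g1 j + g2 j) * (y j - x j))"
      by (simp add: distrib_right sum.distrib)
    ultimately show ?thesis by metis
  qed
  then show "\<exists>\<delta>>0. \<forall>y\<in>Rd d. enorm d (\<lambda>j. y j - x j) < \<delta> \<longrightarrow>
      \<bar>f1 y + f2 y - (f1 x + f2 x) - (\<Sum>j<d. (g1 j + g2 j) * (y j - x j))\<bar>
        \<le> e * enorm d (\<lambda>j. y j - x j)"
    using \<delta>1(1) \<delta>2(1) by (intro exI[of _ "min \<delta>1 \<delta>2"]) auto
qed

lemma has_grad_const: "has_grad d (\<lambda>y. a) (\<lambda>j. 0) x"
  by (auto simp: has_grad_def topspace_Euclidean_space intro!: exI[of _ 1])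

lemma has_grad_sum:
  assumes "\<And>i. i \<in> I \<Longrightarrow> has_grad d (f i) (g i) x"
  shows "has_grad d (\<lambda>y. \<Sum>i\<in>I. f i y) (\<lambda>j. \<Sum>i\<in>I. g i j) x"
  using assms
  by (induction I rule: infinite_finite_induct) (auto intro: has_grad_const has_grad_add)

lemma has_grad_objective:
  assumes "\<And>i p. i \<in> {1..N} \<Longrightarrow> p \<in> {1..P} \<Longrightarrow> has_grad d (f i p) (g i p) x"
  shows "has_grad d (objective N P f)
    (\<lambda>j. 1 / real P * (\<Sum>p=1..P. 1 / real N * (\<Sum>i=1..N. g i p j))) x"
  unfolding objective_def[abs_def]
  using assms by (intro has_grad_cmult has_grad_sum)

lemma has_grad_grad:
  "differentiable_Rd d F \<Longrightarrow> x \<in> Rd d \<Longrightarrow> has_grad d F (grad d F x) x"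
  unfolding differentiable_Rd_def using grad_eq by metis

text \<open>Restriction to a line turns \<open>has_grad\<close> into an ordinary derivative in one
  real variable, to which monotonicity criteria apply.\<close>

lemma has_grad_line_deriv:
  assumes g: "has_grad d F g (\<lambda>j. x j + s * v j)" and x: "x \<in> Rd d" "v \<in> Rd d"
  shows "((\<lambda>t. F (\<lambda>j. x j + t * v j)) has_field_derivative (\<Sum>j<d. g j * v j)) (at s)"
  unfolding has_field_derivative_def has_derivative_at_alt
proof (intro conjI allI impI)
  show "bounded_linear ((*) (\<Sum>j<d. g j * v j))" by (rule bounded_linear_mult_right)
  fix e :: real assume e: "e > 0"
  let ?n = "enorm d v"
  have n: "?n \<ge> 0" by simp
  define e' where "e' = e / (?n + 1)"
  have e': "e' > 0" using e by (simp add: e'_def add_nonneg_pos)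
  have e_le: "e' * ?n \<le> e"
  proof -
    have "e' * ?n \<le> e' * (?n + 1)" using e' by (intro mult_left_mono) auto
    also have "\<dots> = e"
      using n unfolding e'_def by (intro nonzero_eq_divide_eq[THEN iffD1] refl) linarith
    finally show ?thesis .
  qed
  obtain \<delta> where \<delta>: "\<delta> > 0" "\<And>y. y \<in> Rd d \<Longrightarrow> enorm d (\<lambda>j. y j - (x j + s * v j)) < \<delta> \<Longrightarrow>
      \<bar>F y - F (\<lambda>j. x j + s * v j) - (\<Sum>j<d. g j * (y j - (x j + s * v j)))\<bar>
        \<le> e' * enorm d (\<lambda>j. y j - (x j + s * v j))"
    using g e' unfolding has_grad_def by meson
  have "norm (F (\<lambda>j. x j + t * v j) - F (\<lambda>j. x j + s * v j) - (\<Sum>j<d. g j * v j) * (t - s))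
      \<le> e * norm (t - s)" if t: "norm (t - s) < \<delta> / (?n + 1)" for t
  proof -
    let ?y = "\<lambda>j. x j + t * v j"
    have y: "?y \<in> Rd d" using x by (auto simp: topspace_Euclidean_space)
    have diff: "?y j - (x j + s * v j) = (t - s) * v j" for j by (simp add: algebra_simps)
    have en: "enorm d (\<lambda>j. ?y j - (x j + s * v j)) = \<bar>t - s\<bar> * ?n"
      unfolding diff by (simp add: L2_set_def power_mult_distrib sum_distrib_left[symmetric] real_sqrt_mult)
    have "\<bar>t - s\<bar> * ?n \<le> \<bar>t - s\<bar> * (?n + 1)" by (intro mult_left_mono) auto
    also have "\<dots> < \<delta>" using t n by (simp add: field_simps)
    finally have "\<bar>F ?y - F (\<lambda>j. x j + s * v j) - (\<Sum>j<d. g j * ((t - s) * v j))\<bar>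
        \<le> e' * (\<bar>t - s\<bar> * ?n)"
      using \<delta>(2)[OF y] en by (simp only: diff)
    also have "(\<Sum>j<d. g j * ((t - s) * v j)) = (\<Sum>j<d. g j * v j) * (t - s)"
      by (simp add: sum_distrib_left mult_ac)
    also have "e' * (\<bar>t - s\<bar> * ?n) = (e' * ?n) * \<bar>t - s\<bar>" by simp
    also have "\<dots> \<le> e * \<bar>t - s\<bar>"
      using e_le by (intro mult_right_mono) auto
    finally show ?thesis by simp
  qed
  then show "\<exists>da>0. \<forall>y. norm (y - s) < da \<longrightarrow>
      norm (F (\<lambda>j. x j + y * v j) - F (\<lambda>j. x j + s * v j) - (\<Sum>j<d. g j * v j) * (y - s))
        \<le> e * norm (y - s)"
    using \<delta>(1) n by (intro exI[of _ "\<delta> / (?n + 1)"]) (auto intro!: divide_pos_pos add_nonneg_pos)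
qed

section \<open>Cauchy-Schwarz and the quadratic upper bound\<close>

lemma sum_mult_le_enorm: "(\<Sum>j<d. u j * v j) \<le> enorm d u * enorm d v"
proof -
  have "(\<Sum>j<d. u j * v j) \<le> (\<Sum>j<d. \<bar>u j\<bar> * \<bar>v j\<bar>)"
    by (intro sum_mono) (metis abs_ge_self abs_mult)
  then show ?thesis using L2_set_mult_ineq[of u v "{..<d}"] by linarith
qed

text \<open>Up to the constant \<open>F x\<close>, the function \<open>\<phi>\<close> is
  \<open>F\<close> on the segment minus the claimed quadratic bound. Its derivative is the inner
  product of \<open>v\<close> with the change of gradient, minus \<open>L * s\<close> times the
  squared norm of \<open>v\<close>. Cauchy-Schwarz and smoothness make this nonpositive, and
  \<open>\<phi> 1 \<le> \<phi> 0\<close> is the claim.\<close>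

lemma descent_lemma:
  assumes F: "differentiable_Rd d F" "smooth_Rd d L F" and x: "x \<in> Rd d" "v \<in> Rd d"
  shows "F (\<lambda>j. x j + v j) \<le> F x + (\<Sum>j<d. grad d F x j * v j) + L / 2 * (\<Sum>j<d. (v j)\<^sup>2)"
proof -
  let ?n = "enorm d v"
  let ?x = "\<lambda>s j. x j + s * v j"
  define \<phi> where "\<phi> s = F (?x s) - s * (\<Sum>j<d. grad d F x j * v j) - L / 2 * s\<^sup>2 * ?n\<^sup>2" for s
  have mem: "?x s \<in> Rd d" for s using x by (auto simp: topspace_Euclidean_space)
  have "\<phi> 1 \<le> \<phi> 0"
  proof (rule DERIV_nonpos_imp_nonincreasing[where f = \<phi>])
    fix s :: real assume s: "0 \<le> s" "s \<le> 1"
    let ?D = "(\<Sum>j<d. grad d F (?x s) j * v j) - (\<Sum>j<d. grad d F x j * v j) - L * s * ?n\<^sup>2"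
    have "(\<phi> has_field_derivative ?D) (at s)"
      unfolding \<phi>_def[abs_def]
      by (auto intro!: derivative_eq_intros
          has_grad_line_deriv[OF has_grad_grad[OF F(1) mem] x])
    moreover have "?D \<le> 0"
    proof -
      have "(\<Sum>j<d. (grad d F (?x s) j - grad d F x j) * v j)
          \<le> enorm d (\<lambda>j. grad d F (?x s) j - grad d F x j) * ?n"
        by (rule sum_mult_le_enorm)
      also have "\<dots> \<le> (L * enorm d (\<lambda>j. ?x s j - x j)) * ?n"
        using F(2) mem[of s] x(1) unfolding smooth_Rd_def by (intro mult_right_mono) (blast, simp)
      also have "enorm d (\<lambda>j. ?x s j - x j) = s * ?n"
        using s by (simp add: L2_set_def power_mult_distrib sum_distrib_left[symmetric] real_sqrt_mult)
      finally show ?thesis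
        by (simp add: left_diff_distrib sum_subtractf power2_eq_square mult.assoc)
    qed
    ultimately show "\<exists>y. (\<phi> has_field_derivative y) (at s) \<and> y \<le> 0" by blast
  qed simp
  then show ?thesis by (simp add: \<phi>_def enorm_sq)
qed

section \<open>Second moments of the memory update\<close>

lemma second_moment_rand_comp_shift:
  assumes k: "1 \<le> k" "k \<le> d" and j: "j < d"
  shows "measure_pmf.expectation (rand_comp d k x) (\<lambda>y. (b + a * (x j - y j))\<^sup>2) =
    b\<^sup>2 + a\<^sup>2 * (real d / real k - 1) * (x j)\<^sup>2"
proof -
  let ?E = "measure_pmf.expectation (rand_comp d k x)"
  have "?E (\<lambda>y. (b + a * (x j - y j))\<^sup>2) =
      ?E (\<lambda>y. ((b + a * x j)\<^sup>2 - 2 * (b + a * x j) * a * y j) + a\<^sup>2 * (y j)\<^sup>2)"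
    by (intro expectation_cong_finite) (simp add: power2_eq_square algebra_simps)
  also have "\<dots> = ((b + a * x j)\<^sup>2 - 2 * (b + a * x j) * a * x j) + a\<^sup>2 * (real d / real k * (x j)\<^sup>2)"
    using assms
    by (simp add: expectation_add_finite expectation_diff_finite finite_set_rand_comp
        expectation_rand_comp second_moment_rand_comp)
  also have "\<dots> = b\<^sup>2 + a\<^sup>2 * (real d / real k - 1) * (x j)\<^sup>2"
    by (simp add: power2_eq_square algebra_simps)
  finally show ?thesis .
qed

abbreviation worker_mean :: "nat \<Rightarrow> (nat \<Rightarrow> vec) \<Rightarrow> vec" where
  "worker_mean P m j \<equiv> 1 / real P * (\<Sum>p=1..P. m p j)"

text \<open>Since \<open>\<eta> * g = \<eta> * v + \<gamma> * m\<close>, the new memory is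
  \<open>(1 - \<gamma>) * m\<close> plus \<eta> times the centered compression error of
  \<open>g\<close>. The two parts are orthogonal in expectation. For the worker mean, independence
  lets the error variances add, which produces the factor
  \<open>1 / (real P)\<^sup>2\<close>.\<close>

lemma memory_compress_moments:
  fixes v m :: "nat \<Rightarrow> vec" and \<gamma> \<eta> :: real and P :: nat
  assumes k: "1 \<le> k" "k \<le> d" and j: "j < d" and \<eta>: "\<eta> \<noteq> 0"
  defines "g \<equiv> \<lambda>p j. v p j + \<gamma> / \<eta> * m p j"
  defines "M \<equiv> Pi_pmf {1..P} (\<lambda>_. 0) (\<lambda>p. rand_comp d k (g p))"
  shows memory_second_moment: "p \<in> {1..P} \<Longrightarrow>
      measure_pmf.expectation M (\<lambda>b. (m p j + \<eta> * (v p j - b p j))\<^sup>2) =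
      (1 - \<gamma>)\<^sup>2 * (m p j)\<^sup>2 + \<eta>\<^sup>2 * (real d / real k - 1) * (g p j)\<^sup>2"
    and mean_memory_second_moment:
      "measure_pmf.expectation M (\<lambda>b. (worker_mean P (\<lambda>p j. m p j + \<eta> * (v p j - b p j)) j)\<^sup>2) =
      (1 - \<gamma>)\<^sup>2 * (worker_mean P m j)\<^sup>2 +
        1 / (real P)\<^sup>2 * (\<Sum>p=1..P. \<eta>\<^sup>2 * (real d / real k - 1) * (g p j)\<^sup>2)"
proof -
  have upd: "m p j + \<eta> * (v p j - b) = (1 - \<gamma>) * m p j + \<eta> * (g p j - b)" for p b
    using \<eta> by (simp add: g_def field_simps)
  show "measure_pmf.expectation M (\<lambda>b. (m p j + \<eta> * (v p j - b p j))\<^sup>2) =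
      (1 - \<gamma>)\<^sup>2 * (m p j)\<^sup>2 + \<eta>\<^sup>2 * (real d / real k - 1) * (g p j)\<^sup>2" if "p \<in> {1..P}"
    unfolding upd M_def
    using that expectation_Pi_pmf_component[of "{1..P}" p "\<lambda>_. 0" "\<lambda>p. rand_comp d k (g p)"
        "\<lambda>b. ((1 - \<gamma>) * m p j + \<eta> * (g p j - b j))\<^sup>2"]
      second_moment_rand_comp_shift[OF k j, of "g p" "(1 - \<gamma>) * m p j" \<eta>]
    by (simp add: power_mult_distrib)
  have mean: "worker_mean P (\<lambda>p j. m p j + \<eta> * (v p j - b p j)) j =
      (1 - \<gamma>) * worker_mean P m j + (\<Sum>p=1..P. \<eta> / real P * (g p j - b p j))" for b
    unfolding upd by (simp add: sum.distrib sum_distrib_left distrib_left mult_ac)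
  have 0: "measure_pmf.expectation (rand_comp d k (g p)) (\<lambda>y. \<eta> / real P * (g p j - y j)) = 0" for p
    using k j by (simp add: expectation_diff_finite finite_set_rand_comp expectation_rand_comp)
  have 2: "measure_pmf.expectation (rand_comp d k (g p)) (\<lambda>y. (\<eta> / real P * (g p j - y j))\<^sup>2) =
      1 / (real P)\<^sup>2 * (\<eta>\<^sup>2 * (real d / real k - 1) * (g p j)\<^sup>2)" for p
    using second_moment_rand_comp_shift[OF k j, of "g p" 0 "\<eta> / real P"]
    by (simp add: power_divide)
  show "measure_pmf.expectation M (\<lambda>b. (worker_mean P (\<lambda>p j. m p j + \<eta> * (v p j - b p j)) j)\<^sup>2) =
      (1 - \<gamma>)\<^sup>2 * (worker_mean P m j)\<^sup>2 +
        1 / (real P)\<^sup>2 * (\<Sum>p=1..P. \<eta>\<^sup>2 * (real d / real k - 1) * (g p j)\<^sup>2)"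
  proof -
    have "measure_pmf.expectation M (\<lambda>b. (worker_mean P (\<lambda>p j. m p j + \<eta> * (v p j - b p j)) j)\<^sup>2) =
      ((1 - \<gamma>) * worker_mean P m j)\<^sup>2 + (\<Sum>p=1..P.
        measure_pmf.expectation (rand_comp d k (g p)) (\<lambda>y. (\<eta> / real P * (g p j - y j))\<^sup>2))"
      unfolding mean M_def
      by (rule second_moment_centered_sum_Pi_pmf) (auto simp only: 0 finite_set_rand_comp[OF k])
    then show ?thesis
      unfolding 2 by (simp only: power_mult_distrib[of "1 - \<gamma>"] sum_distrib_left[of "1 / (real P)\<^sup>2"])
  qed
qed

text \<open>Splitting around the mean \<open>s\<close> leaves the nonnegative remainder
  \<open>card A * (s - b)\<^sup>2\<close>. The variance hypothesis measures deviation from the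
  global gradient; this inequality lets it control deviations from each worker's own mean
  gradient.\<close>

lemma sum_sq_deviation_le:
  fixes a :: "'a \<Rightarrow> real"
  assumes "finite A"
  shows "(\<Sum>i\<in>A. (a i - (\<Sum>i\<in>A. a i) / card A)\<^sup>2) \<le> (\<Sum>i\<in>A. (a i - b)\<^sup>2)"
proof (cases "A = {}")
  case False
  then have c: "real (card A) > 0" using assms card_gt_0_iff by fastforce
  define s where "s = (\<Sum>i\<in>A. a i) / card A"
  have s: "(\<Sum>i\<in>A. a i) = s * card A" using c by (simp add: s_def)
  have "(\<Sum>i\<in>A. (a i - b)\<^sup>2) = (\<Sum>i\<in>A. (a i - s)\<^sup>2 + (s - b)\<^sup>2 + 2 * (s - b) * (a i - s))"
    by (intro sum.cong refl) (simp add: power2_eq_square algebra_simps)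
  also have "\<dots> = (\<Sum>i\<in>A. (a i - s)\<^sup>2) + card A * (s - b)\<^sup>2 + 2 * (s - b) * (\<Sum>i\<in>A. a i - s)"
    by (simp add: sum.distrib sum_distrib_left)
  also have "(\<Sum>i\<in>A. a i - s) = 0" using s by (simp add: sum_subtractf)
  finally show ?thesis unfolding s_def[symmetric] by simp
qed simp

section \<open>One iteration\<close>

text \<open>The bound on \<gamma> leaves a contraction by \<open>1 - \<gamma>\<close> after paying
  for the memory that is fed back through the compressor. The bound on \<open>\<eta> * L\<close>
  absorbs the second-order term of the descent step. The last condition keeps the gradient part of
  the compression noise below \<open>\<eta> / 8\<close> times the squared gradient norm.\<close>

locale ssgd_ef_setting =
  fixes d N P k :: nat and f :: "nat \<Rightarrow> nat \<Rightarrow> vec \<Rightarrow> real" and L V \<gamma> \<eta> :: real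
  assumes N: "1 \<le> N" and P: "1 \<le> P" and k: "1 \<le> k" "k \<le> d"
    and L: "0 < L"
    and diff: "\<And>i p. i \<in> {1..N} \<Longrightarrow> p \<in> {1..P} \<Longrightarrow> differentiable_Rd d (f i p)"
    and smooth: "smooth_Rd d L (objective N P f)"
    and var: "bounded_variance d N P V f"
    and \<gamma>: "0 < \<gamma>" "\<gamma> + 2 * (real d / real k) * \<gamma> \<le> 1"
    and \<eta>: "0 < \<eta>" "\<eta> * L \<le> 1 / 2" "\<eta>\<^sup>2 * L\<^sup>2 * (real d / real k) / (\<gamma> * real P) \<le> 1 / 8"
begin

abbreviation "F \<equiv> objective N P f"
abbreviation "G x \<equiv> \<Sum>j<d. (grad d F x j)\<^sup>2"
abbreviation "draws \<equiv> Pi_pmf {1..P} 0 (\<lambda>_. pmf_of_set {1..N})"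
abbreviation "sgrad x i p \<equiv> grad d (f (i p) p) x"
abbreviation "compressed x m i \<equiv>
  Pi_pmf {1..P} (\<lambda>_. 0) (\<lambda>p. rand_comp d k (\<lambda>j. sgrad x i p j + \<gamma> / \<eta> * m p j))"
abbreviation "next_x x b j \<equiv> x j - \<eta> * worker_mean P b j"
abbreviation "next_m x m i b p j \<equiv> m p j + \<eta> * (sgrad x i p j - b p j)"
abbreviation "step \<equiv> ssgd_ef_step d N P k f \<gamma> \<eta>"

section \<open>Memories, their defect and the virtual iterate\<close>

definition memory :: "(nat \<Rightarrow> vec) \<Rightarrow> real" where
  "memory m = 1 / real P * (\<Sum>p=1..P. \<Sum>j<d. (m p j)\<^sup>2)"

text \<open>Expanding the square shows that this is \<open>1 / (real P)\<^sup>2\<close> times the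
  sum of the inner products of the memories of distinct workers. It measures the failure of
  orthogonality between workers.\<close>

definition defect :: "(nat \<Rightarrow> vec) \<Rightarrow> real" where
  "defect m = (\<Sum>j<d. (worker_mean P m j)\<^sup>2 - 1 / (real P)\<^sup>2 * (\<Sum>p=1..P. (m p j)\<^sup>2))"

definition virtual :: "vec \<Rightarrow> (nat \<Rightarrow> vec) \<Rightarrow> vec" where
  "virtual x m = (\<lambda>j. x j - worker_mean P m j)"

text \<open>The step also changes memories at indices outside \<open>{1..P}\<close>, using gradients
  of functions about which nothing is assumed. Membership is therefore demanded for the actual
  workers only.\<close>

definition admissible :: "vec \<Rightarrow> (nat \<Rightarrow> vec) \<Rightarrow> bool" where
  "admissible x m \<longleftrightarrow> x \<in> Rd d \<and> (\<forall>p\<in>{1..P}. m p \<in> Rd d)"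

lemma mean_memory_eq: "(\<Sum>j<d. (worker_mean P m j)\<^sup>2) = defect m + memory m / real P"
  using P by (simp add: defect_def memory_def sum_subtractf sum_distrib_left sum_divide_distrib
      sum.swap[of _ "{..<d}"] power2_eq_square)

lemma finite_draws: "finite (set_pmf draws)"
  using N by (intro finite_set_Pi_pmf) auto

lemma finite_compressed: "finite (set_pmf (compressed x m i))"
  using k by (intro finite_set_Pi_pmf finite_set_rand_comp) auto

lemma step_eq: "step (x, m) = bind_pmf draws (\<lambda>i. bind_pmf (compressed x m i)
    (\<lambda>b. return_pmf (next_x x b, next_m x m i b)))"
  by (simp add: ssgd_ef_step_def Let_def)

lemma finite_step: "finite (set_pmf (step s))"
  by (cases s) (simp only: step_eq set_bind_pmf set_return_pmf finite_UN_I finite_draws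
      finite_compressed finite.intros)

lemma expectation_step:
  fixes h :: "vec \<times> (nat \<Rightarrow> vec) \<Rightarrow> real"
  shows "measure_pmf.expectation (step (x, m)) h = measure_pmf.expectation draws
    (\<lambda>i. measure_pmf.expectation (compressed x m i) (\<lambda>b. h (next_x x b, next_m x m i b)))"
proof -
  have ret: "finite (set_pmf (return_pmf a))" for a :: "vec \<times> (nat \<Rightarrow> vec)"
    by simp
  show ?thesis
    unfolding step_eq
    by (simp only: expectation_bind_finite[OF finite_draws] expectation_bind_finite[OF finite_compressed ret]
        set_bind_pmf set_return_pmf finite_UN_I finite_compressed finite.intros expectation_return_pmf)
qed

lemma draws_range: "i \<in> set_pmf draws \<Longrightarrow> p \<in> {1..P} \<Longrightarrow> i p \<in> {1..N}"
  using N by (auto simp: set_Pi_pmf PiE_dflt_def)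

lemma grad_mem: "differentiable_Rd d h \<Longrightarrow> x \<in> Rd d \<Longrightarrow> grad d h x \<in> Rd d"
  using has_grad_grad has_grad_def by blast

lemma has_grad_F: "x \<in> Rd d \<Longrightarrow> has_grad d F
    (\<lambda>j. 1 / real P * (\<Sum>p=1..P. 1 / real N * (\<Sum>i=1..N. grad d (f i p) x j))) x"
  by (intro has_grad_objective has_grad_grad diff)

lemma diff_F: "differentiable_Rd d F"
  unfolding differentiable_Rd_def using has_grad_F by blast

lemma grad_F: "x \<in> Rd d \<Longrightarrow>
    grad d F x j = 1 / real P * (\<Sum>p=1..P. 1 / real N * (\<Sum>i=1..N. grad d (f i p) x j))"
  using grad_eq[OF has_grad_F] by simp

text \<open>The hypotheses on \<open>F\<close> concern points of \<open>Rd d\<close> only, so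
  membership is carried along the run. Compression preserves it because it rescales or zeroes each
  coordinate.\<close>

lemma step_admissible:
  assumes "admissible x m" "(x', m') \<in> set_pmf (step (x, m))"
  shows "admissible x' m'"
proof -
  obtain i b where i: "i \<in> set_pmf draws" and b: "b \<in> set_pmf (compressed x m i)"
    and eq: "x' = next_x x b" "m' = next_m x m i b"
    using assms(2) by (auto simp: step_eq)
  have s: "sgrad x i p \<in> Rd d" if "p \<in> {1..P}" for p
    using grad_mem[OF diff[OF draws_range[OF i that] that]] assms(1) by (simp add: admissible_def)
  have "b p \<in> Rd d" if p: "p \<in> {1..P}" for p
  proof -
    have "b p \<in> set_pmf (rand_comp d k (\<lambda>j. sgrad x i p j + \<gamma> / \<eta> * m p j))"
      using b p by (auto simp: set_Pi_pmf PiE_dflt_def)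
    moreover have "(\<lambda>j. sgrad x i p j + \<gamma> / \<eta> * m p j) \<in> Rd d"
      using s[OF p] assms(1) p by (auto simp: admissible_def topspace_Euclidean_space)
    ultimately show ?thesis
      by (auto simp: rand_comp_def topspace_Euclidean_space)
  qed
  then show ?thesis
    using s assms(1) unfolding eq by (auto simp: admissible_def topspace_Euclidean_space)
qed

text \<open>The compression errors of different workers are uncorrelated, so the mean memory and the
  memories satisfy the same recursion up to the factor \<open>1 / P\<close>, without any inequality.\<close>

lemma expectation_defect_step:
  "measure_pmf.expectation (step (x, m)) (\<lambda>(x, m). defect m) = (1 - \<gamma>)\<^sup>2 * defect m"
proof -
  \<comment> \<open>The identity holds already conditionally on the drawn indices
    \<open>i\<close>.\<close>
  have "measure_pmf.expectation (compressed x m i) (\<lambda>b. defect (next_m x m i b)) =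
      (1 - \<gamma>)\<^sup>2 * defect m" for i
  proof -
    have "measure_pmf.expectation (compressed x m i) (\<lambda>b. defect (next_m x m i b)) =
        (\<Sum>j<d. measure_pmf.expectation (compressed x m i) (\<lambda>b. (worker_mean P (next_m x m i b) j)\<^sup>2)
          - 1 / (real P)\<^sup>2 * (\<Sum>p=1..P. measure_pmf.expectation (compressed x m i) (\<lambda>b. (next_m x m i b p j)\<^sup>2)))"
      unfolding defect_def
      by (simp only: expectation_sum_finite[OF finite_compressed]
          expectation_diff_finite[OF finite_compressed] integral_mult_right_zero)
    also have "\<dots> = (\<Sum>j<d. (1 - \<gamma>)\<^sup>2 * ((worker_mean P m j)\<^sup>2 - 1 / (real P)\<^sup>2 * (\<Sum>p=1..P. (m p j)\<^sup>2)))"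
    proof (intro sum.cong refl)
      fix j assume j: "j \<in> {..<d}"
      \<comment> \<open>The error variances \<open>?R p\<close> enter both second moments with the
        same weight \<open>1 / (real P)\<^sup>2\<close> and cancel in the difference.\<close>
      let ?R = "\<lambda>p. \<eta>\<^sup>2 * (real d / real k - 1) * (sgrad x i p j + \<gamma> / \<eta> * m p j)\<^sup>2"
      have "(\<Sum>p=1..P. measure_pmf.expectation (compressed x m i) (\<lambda>b. (next_m x m i b p j)\<^sup>2)) =
          (\<Sum>p=1..P. (1 - \<gamma>)\<^sup>2 * (m p j)\<^sup>2 + ?R p)"
        using j \<eta> by (intro sum.cong refl memory_second_moment[OF k]) auto
      moreover have "measure_pmf.expectation (compressed x m i) (\<lambda>b. (worker_mean P (next_m x m i b) j)\<^sup>2)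
          = (1 - \<gamma>)\<^sup>2 * (worker_mean P m j)\<^sup>2 + 1 / (real P)\<^sup>2 * (\<Sum>p=1..P. ?R p)"
        using j \<eta> by (intro mean_memory_second_moment[OF k]) auto
      ultimately show "measure_pmf.expectation (compressed x m i) (\<lambda>b. (worker_mean P (next_m x m i b) j)\<^sup>2)
          - 1 / (real P)\<^sup>2 * (\<Sum>p=1..P. measure_pmf.expectation (compressed x m i) (\<lambda>b. (next_m x m i b p j)\<^sup>2))
          = (1 - \<gamma>)\<^sup>2 * ((worker_mean P m j)\<^sup>2 - 1 / (real P)\<^sup>2 * (\<Sum>p=1..P. (m p j)\<^sup>2))"
        by (simp only: sum.distrib distrib_left right_diff_distrib sum_distrib_left[symmetric])
          (simp add: mult_ac)
    qed
    finally show ?thesis by (simp only: defect_def sum_distrib_left)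
  qed
  then show ?thesis by (simp add: expectation_step)
qed

section \<open>Moments of the stochastic gradients\<close>

lemma expectation_draws_component:
  "p \<in> {1..P} \<Longrightarrow> measure_pmf.expectation draws (\<lambda>i. h (i p)) = (\<Sum>i=1..N. h i) / real N"
  for h :: "nat \<Rightarrow> real"
  using N by (subst expectation_Pi_pmf_component[where h = h]) (simp_all add: integral_pmf_of_set)

lemma sum_sgrad_deviation_le:
  assumes "x \<in> Rd d"
  shows "1 / real P * (\<Sum>p=1..P. (\<Sum>i=1..N. \<Sum>j<d. (grad d (f i p) x j - grad d F x j)\<^sup>2) / real N) \<le> V"
proof -
  have "1 / real P * (\<Sum>p=1..P. (\<Sum>i=1..N. \<Sum>j<d. (grad d (f i p) x j - grad d F x j)\<^sup>2) / real N) =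
    1 / (real N * real P) * (\<Sum>i=1..N. \<Sum>p=1..P.
       (enorm d (\<lambda>j. grad d (f i p) x j - grad d (objective N P f) x j))\<^sup>2)"
    unfolding enorm_sq by (subst sum.swap) (simp add: sum_divide_distrib sum_distrib_left mult_ac)
  then show ?thesis using var assms by (simp add: bounded_variance_def)
qed

lemma expectation_sgrad:
  assumes "x \<in> Rd d"
  shows "measure_pmf.expectation draws (\<lambda>i. worker_mean P (sgrad x i) j) = grad d F x j"
proof -
  have "measure_pmf.expectation draws (\<lambda>i. worker_mean P (sgrad x i) j) =
      1 / real P * (\<Sum>p=1..P. measure_pmf.expectation draws (\<lambda>i. grad d (f (i p) p) x j))"
    by (simp only: expectation_sum_finite[OF finite_draws] integral_mult_right_zero)
  also have "(\<Sum>p=1..P. measure_pmf.expectation draws (\<lambda>i. grad d (f (i p) p) x j)) =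
      (\<Sum>p=1..P. (\<Sum>i=1..N. grad d (f i p) x j) / real N)"
    by (intro sum.cong refl expectation_draws_component)
  finally show ?thesis using grad_F[OF assms] by simp
qed

text \<open>Averaging over independent workers divides the variance by \<open>P\<close>.\<close>

lemma expectation_mean_sgrad_sq:
  assumes x: "x \<in> Rd d"
  shows "measure_pmf.expectation draws (\<lambda>i. \<Sum>j<d. (worker_mean P (sgrad x i) j)\<^sup>2)
    \<le> G x + V / real P"
proof -
  \<comment> \<open>The workers may be heterogeneous, so each gradient is centered at its own
    worker's mean \<open>?\<mu> p\<close>, not at the gradient of \<open>F\<close>. This gives
    mean-zero summands; minimality of the mean then replaces \<open>?\<mu> p\<close> by the gradient
    of \<open>F\<close>.\<close>
  let ?\<mu> = "\<lambda>p j. (\<Sum>i=1..N. grad d (f i p) x j) / real N"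
  let ?h = "\<lambda>j p u. 1 / real P * (grad d (f u p) x j - ?\<mu> p j)"
  have mean: "worker_mean P (sgrad x i) j = grad d F x j + (\<Sum>p=1..P. ?h j p (i p))" for i j
    unfolding grad_F[OF x]
    by (simp add: sum_subtractf diff_divide_distrib sum_divide_distrib)
  have 0: "measure_pmf.expectation (pmf_of_set {1..N}) (?h j p) = 0" for j p
    using N by (simp add: integral_pmf_of_set sum_divide_distrib[symmetric] sum_subtractf)
  have 2: "measure_pmf.expectation (pmf_of_set {1..N}) (\<lambda>u. (?h j p u)\<^sup>2) \<le>
      1 / (real P)\<^sup>2 * ((\<Sum>i=1..N. (grad d (f i p) x j - grad d F x j)\<^sup>2) / real N)" for j p
  proof -
    have "measure_pmf.expectation (pmf_of_set {1..N}) (\<lambda>u. (?h j p u)\<^sup>2) =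
      1 / (real P)\<^sup>2 * ((\<Sum>i=1..N. (grad d (f i p) x j - ?\<mu> p j)\<^sup>2) / real N)"
      using N by (simp add: integral_pmf_of_set power_divide sum_divide_distrib[symmetric])
    also have "\<dots> \<le> 1 / (real P)\<^sup>2 * ((\<Sum>i=1..N. (grad d (f i p) x j - grad d F x j)\<^sup>2) / real N)"
      using sum_sq_deviation_le[of "{1..N}" "\<lambda>i. grad d (f i p) x j" "grad d F x j"]
      by (intro mult_left_mono divide_right_mono) auto
    finally show ?thesis .
  qed
  have "measure_pmf.expectation draws (\<lambda>i. \<Sum>j<d. (worker_mean P (sgrad x i) j)\<^sup>2) =
      (\<Sum>j<d. measure_pmf.expectation draws (\<lambda>i. (grad d F x j + (\<Sum>p=1..P. ?h j p (i p)))\<^sup>2))"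
    unfolding mean by (rule expectation_sum_finite[OF finite_draws])
  also have "\<dots> = (\<Sum>j<d. (grad d F x j)\<^sup>2 +
      (\<Sum>p=1..P. measure_pmf.expectation (pmf_of_set {1..N}) (\<lambda>u. (?h j p u)\<^sup>2)))"
    using N by (intro sum.cong refl second_moment_centered_sum_Pi_pmf 0) auto
  also have "\<dots> \<le> (\<Sum>j<d. (grad d F x j)\<^sup>2 +
      (\<Sum>p=1..P. 1 / (real P)\<^sup>2 * ((\<Sum>i=1..N. (grad d (f i p) x j - grad d F x j)\<^sup>2) / real N)))"
    by (intro sum_mono add_left_mono 2)
  also have "\<dots> = G x + 1 / real P *
      (1 / real P * (\<Sum>p=1..P. (\<Sum>i=1..N. \<Sum>j<d. (grad d (f i p) x j - grad d F x j)\<^sup>2) / real N))"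
  proof -
    let ?X = "\<lambda>j p i. (grad d (f i p) x j - grad d F x j)\<^sup>2"
    have "(\<Sum>j<d. \<Sum>p=1..P. 1 / (real P)\<^sup>2 * ((\<Sum>i=1..N. ?X j p i) / real N)) =
        (\<Sum>p=1..P. \<Sum>j<d. 1 / (real P)\<^sup>2 * ((\<Sum>i=1..N. ?X j p i) / real N))"
      by (rule sum.swap)
    also have "\<dots> = (\<Sum>p=1..P. 1 / (real P)\<^sup>2 * ((\<Sum>j<d. \<Sum>i=1..N. ?X j p i) / real N))"
      by (simp only: sum_divide_distrib sum_distrib_left)
    also have "\<dots> = (\<Sum>p=1..P. 1 / (real P)\<^sup>2 * ((\<Sum>i=1..N. \<Sum>j<d. ?X j p i) / real N))"
      by (simp only: sum.swap[of _ "{1..N}" "{..<d}"])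
    finally show ?thesis
      by (simp only: sum.distrib sum_distrib_left[symmetric])
        (simp add: power2_eq_square)
  qed
  also have "\<dots> \<le> G x + 1 / real P * V"
    by (intro add_left_mono mult_left_mono sum_sgrad_deviation_le x) simp
  finally show ?thesis by simp
qed

text \<open>The workers are compressed separately, so their individual squared gradients matter
  here, and these keep the full variance \<open>V\<close>.\<close>

lemma expectation_sgrad_sq:
  assumes x: "x \<in> Rd d"
  shows "measure_pmf.expectation draws (\<lambda>i. 1 / real P * (\<Sum>p=1..P. \<Sum>j<d. (sgrad x i p j)\<^sup>2))
    \<le> G x + V"
proof -
  let ?D = "\<lambda>i p j. grad d (f i p) x j - grad d F x j"
  \<comment> \<open>A single worker's mean gradient may differ from that of \<open>F\<close>; the
    cross term vanishes only after summation over all workers.\<close>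
  have dev: "(\<Sum>p=1..P. \<Sum>i=1..N. ?D i p j) = 0" for j
  proof -
    have "real P * real N * grad d F x j = (\<Sum>p=1..P. \<Sum>i=1..N. grad d (f i p) x j)"
      using N P by (simp add: grad_F[OF x] sum_divide_distrib[symmetric])
    then show ?thesis by (simp add: sum_subtractf mult_ac)
  qed
  have sq: "(grad d (f i p) x j)\<^sup>2 = (?D i p j)\<^sup>2 + (grad d F x j)\<^sup>2 + 2 * grad d F x j * ?D i p j" for i p j
    by (simp add: power2_eq_square algebra_simps)
  have "measure_pmf.expectation draws (\<lambda>i. 1 / real P * (\<Sum>p=1..P. \<Sum>j<d. (sgrad x i p j)\<^sup>2)) =
      1 / real P * (\<Sum>p=1..P. measure_pmf.expectation draws (\<lambda>i. \<Sum>j<d. (grad d (f (i p) p) x j)\<^sup>2))"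
    by (simp only: expectation_sum_finite[OF finite_draws] integral_mult_right_zero)
  also have "(\<Sum>p=1..P. measure_pmf.expectation draws (\<lambda>i. \<Sum>j<d. (grad d (f (i p) p) x j)\<^sup>2)) =
      (\<Sum>p=1..P. (\<Sum>i=1..N. \<Sum>j<d. (grad d (f i p) x j)\<^sup>2) / real N)"
    by (intro sum.cong refl expectation_draws_component)
  also have "\<dots> = (\<Sum>p=1..P. \<Sum>i=1..N. \<Sum>j<d. (?D i p j)\<^sup>2) / real N + real P * G x +
      (\<Sum>j<d. 2 * grad d F x j * (\<Sum>p=1..P. \<Sum>i=1..N. ?D i p j)) / real N"
    using N unfolding sq
    by (simp add: sum.distrib sum_divide_distrib[symmetric] add_divide_distrib sum_distrib_left
        sum.swap[of _ "{..<d}"]) (simp add: sum_divide_distrib)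
  also have "\<dots> = (\<Sum>p=1..P. (\<Sum>i=1..N. \<Sum>j<d. (?D i p j)\<^sup>2) / real N) + real P * G x"
    unfolding dev by (simp add: sum_divide_distrib)
  also have "1 / real P * \<dots> = G x + 1 / real P * (\<Sum>p=1..P. (\<Sum>i=1..N. \<Sum>j<d. (?D i p j)\<^sup>2) / real N)"
    using P by (simp add: field_simps)
  also have "\<dots> \<le> G x + V"
    using sum_sgrad_deviation_le[OF x] by simp
  finally show ?thesis .
qed

section \<open>One-step estimates and the potential\<close>

lemma virtual_mem: "admissible x m \<Longrightarrow> virtual x m \<in> Rd d"
  by (simp add: admissible_def virtual_def topspace_Euclidean_space)

text \<open>The compressor acts on the gradient plus fed-back memory; the square of this sum is at
  most twice the sum of the squares. The memory share costs \<open>2 * q * \<gamma>\<^sup>2\<close>,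
  which is paid by giving up one of the two factors \<open>1 - \<gamma>\<close>.\<close>

lemma compressed_memory_le:
  "(1 - \<gamma>)\<^sup>2 * a\<^sup>2 + \<eta>\<^sup>2 * (real d / real k - 1) * (v + \<gamma> / \<eta> * a)\<^sup>2
    \<le> (1 - \<gamma>) * a\<^sup>2 + 2 * \<eta>\<^sup>2 * (real d / real k) * v\<^sup>2"
proof -
  define q where "q = real d / real k"
  have q: "q \<ge> 0" by (simp add: q_def)
  define w where "w = \<gamma> / \<eta> * a"
  have w: "\<eta> * w = \<gamma> * a" using \<eta> by (simp add: w_def)
  have "\<eta>\<^sup>2 * (q - 1) * (v + w)\<^sup>2 \<le> \<eta>\<^sup>2 * q * (v + w)\<^sup>2"
    by (intro mult_right_mono mult_left_mono) auto
  also have "\<dots> \<le> \<eta>\<^sup>2 * q * (2 * v\<^sup>2 + 2 * w\<^sup>2)"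
  proof (intro mult_left_mono)
    show "(v + w)\<^sup>2 \<le> 2 * v\<^sup>2 + 2 * w\<^sup>2"
      using zero_le_power2[of "v - w"] by (simp add: power2_eq_square algebra_simps)
  qed (use q in simp)
  also have "\<dots> = 2 * \<eta>\<^sup>2 * q * v\<^sup>2 + 2 * q * (\<eta> * w)\<^sup>2"
    by (simp add: power2_eq_square algebra_simps)
  also have "\<dots> = 2 * \<eta>\<^sup>2 * q * v\<^sup>2 + 2 * q * \<gamma>\<^sup>2 * a\<^sup>2"
    unfolding w by (simp add: power2_eq_square)
  finally have 1: "\<eta>\<^sup>2 * (q - 1) * (v + w)\<^sup>2 \<le> 2 * \<eta>\<^sup>2 * q * v\<^sup>2 + 2 * q * \<gamma>\<^sup>2 * a\<^sup>2" .
  \<comment> \<open>This is the locale's bound on \<gamma>, multiplied by \<gamma>.\<close>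
  have "\<gamma> * (\<gamma> + 2 * q * \<gamma>) \<le> \<gamma> * 1"
    using \<gamma> unfolding q_def by (intro mult_left_mono) auto
  then have "(1 - \<gamma>)\<^sup>2 + 2 * q * \<gamma>\<^sup>2 \<le> 1 - \<gamma>"
    by (simp add: power2_eq_square algebra_simps)
  then have "((1 - \<gamma>)\<^sup>2 + 2 * q * \<gamma>\<^sup>2) * a\<^sup>2 \<le> (1 - \<gamma>) * a\<^sup>2"
    by (intro mult_right_mono) auto
  with 1 show ?thesis
    unfolding q_def[symmetric] w_def[symmetric] distrib_right by linarith
qed

lemma expectation_memory_step:
  assumes x: "x \<in> Rd d"
  shows "measure_pmf.expectation (step (x, m)) (\<lambda>(x, m). memory m)
    \<le> (1 - \<gamma>) * memory m + 2 * \<eta>\<^sup>2 * (real d / real k) * (G x + V)"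
proof -
  let ?S = "\<lambda>i. 1 / real P * (\<Sum>p=1..P. \<Sum>j<d. (sgrad x i p j)\<^sup>2)"
  have le: "measure_pmf.expectation (compressed x m i) (\<lambda>b. memory (next_m x m i b))
      \<le> (1 - \<gamma>) * memory m + 2 * \<eta>\<^sup>2 * (real d / real k) * ?S i" for i
  proof -
    have "measure_pmf.expectation (compressed x m i) (\<lambda>b. memory (next_m x m i b)) =
        1 / real P * (\<Sum>p=1..P. \<Sum>j<d.
          measure_pmf.expectation (compressed x m i) (\<lambda>b. (next_m x m i b p j)\<^sup>2))"
      unfolding memory_def
      by (simp only: expectation_sum_finite[OF finite_compressed] integral_mult_right_zero)
    also have "(\<Sum>p=1..P. \<Sum>j<d.
          measure_pmf.expectation (compressed x m i) (\<lambda>b. (next_m x m i b p j)\<^sup>2)) =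
        (\<Sum>p=1..P. \<Sum>j<d. (1 - \<gamma>)\<^sup>2 * (m p j)\<^sup>2 +
          \<eta>\<^sup>2 * (real d / real k - 1) * (sgrad x i p j + \<gamma> / \<eta> * m p j)\<^sup>2)"
      using \<eta> by (intro sum.cong refl memory_second_moment[OF k]) auto
    also have "1 / real P * \<dots> \<le> 1 / real P * (\<Sum>p=1..P. \<Sum>j<d. (1 - \<gamma>) * (m p j)\<^sup>2 + 2 * \<eta>\<^sup>2 * (real d / real k) * (sgrad x i p j)\<^sup>2)"
      by (intro mult_left_mono sum_mono compressed_memory_le) simp
    also have "\<dots> = (1 - \<gamma>) * memory m + 2 * \<eta>\<^sup>2 * (real d / real k) * ?S i"
      unfolding memory_def
      by (simp only: sum.distrib sum_distrib_left[symmetric] distrib_left mult.left_commute)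
    finally show ?thesis .
  qed
  have "measure_pmf.expectation (step (x, m)) (\<lambda>(x, m). memory m) \<le>
      measure_pmf.expectation draws (\<lambda>i. (1 - \<gamma>) * memory m + 2 * \<eta>\<^sup>2 * (real d / real k) * ?S i)"
    unfolding expectation_step prod.case
    by (intro expectation_mono_finite finite_draws le)
  also have "\<dots> = (1 - \<gamma>) * memory m + 2 * \<eta>\<^sup>2 * (real d / real k) * measure_pmf.expectation draws ?S"
    by (subst expectation_add_finite[OF finite_draws])
      (simp only: integral_mult_right_zero lebesgue_integral_const measure_pmf.prob_space scaleR_one)
  also have "\<dots> \<le> (1 - \<gamma>) * memory m + 2 * \<eta>\<^sup>2 * (real d / real k) * (G x + V)"
    by (intro add_left_mono mult_left_mono expectation_sgrad_sq x) simp
  finally show ?thesis .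
qed

text \<open>The descent lemma at the virtual iterate yields the gradient there, while the stochastic
  gradient is taken at \<open>x\<close>. Smoothness bounds the mismatch by \<open>L\<close> times
  the norm of the mean memory, which is the distance between the two points.\<close>

lemma expectation_virtual_step:
  assumes adm: "admissible x m"
  shows "measure_pmf.expectation (step (x, m)) (\<lambda>(x, m). F (virtual x m))
    \<le> F (virtual x m) - \<eta> / 4 * G x + L * \<eta>\<^sup>2 * V / (2 * real P)
      + \<eta> * L\<^sup>2 / 2 * (\<Sum>j<d. (worker_mean P m j)\<^sup>2)"
proof -
  let ?z = "virtual x m"
  have x: "x \<in> Rd d" using adm by (simp add: admissible_def)
  have z: "?z \<in> Rd d"
    using adm by (rule virtual_mem)
  let ?v = "\<lambda>i j. worker_mean P (sgrad x i) j"
  \<comment> \<open>The compressed vectors \<open>b\<close> change the iterate and the mean memory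
    by the same amount, so they cancel.\<close>
  have z': "virtual (next_x x b) (next_m x m i b) = (\<lambda>j. ?z j + - \<eta> * ?v i j)" for b i
    by (simp add: fun_eq_iff virtual_def sum.distrib sum_subtractf sum_distrib_left[symmetric]
        right_diff_distrib diff_divide_distrib add_divide_distrib)
  have le: "F (\<lambda>j. ?z j + - \<eta> * ?v i j) \<le>
      (F ?z - \<eta> * (\<Sum>j<d. grad d F ?z j * ?v i j)) + L * \<eta>\<^sup>2 / 2 * (\<Sum>j<d. (?v i j)\<^sup>2)"
    if "i \<in> set_pmf draws" for i
  proof -
    have "(\<lambda>j. - \<eta> * ?v i j) \<in> Rd d"
      using grad_mem[OF diff[OF draws_range[OF that]] x] by (auto simp: topspace_Euclidean_space)
    from descent_lemma[OF diff_F smooth z this] show ?thesis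
      by (simp only: power_mult_distrib mult.left_commute[of _ "- \<eta>"] sum_distrib_left[symmetric] power2_minus)
        (simp add: mult_ac)
  qed
  have lin: "measure_pmf.expectation draws (\<lambda>i. \<Sum>j<d. grad d F ?z j * ?v i j) =
      (\<Sum>j<d. grad d F ?z j * grad d F x j)"
    unfolding expectation_sgrad[OF x, symmetric] integral_mult_right_zero[symmetric]
    by (rule expectation_sum_finite[OF finite_draws])
  have "measure_pmf.expectation (step (x, m)) (\<lambda>(x, m). F (virtual x m)) \<le>
    measure_pmf.expectation draws (\<lambda>i.
      (F ?z - \<eta> * (\<Sum>j<d. grad d F ?z j * ?v i j)) + L * \<eta>\<^sup>2 / 2 * (\<Sum>j<d. (?v i j)\<^sup>2))"
    unfolding expectation_step prod.case z' lebesgue_integral_const measure_pmf.prob_space scaleR_one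
    by (intro expectation_mono_finite finite_draws le)
  also have "\<dots> = (F ?z - \<eta> * (\<Sum>j<d. grad d F ?z j * grad d F x j))
      + L * \<eta>\<^sup>2 / 2 * measure_pmf.expectation draws (\<lambda>i. \<Sum>j<d. (?v i j)\<^sup>2)"
    unfolding lin[symmetric]
    by (simp only: expectation_add_finite[OF finite_draws] expectation_diff_finite[OF finite_draws]
        integral_mult_right_zero lebesgue_integral_const measure_pmf.prob_space scaleR_one)
  also have "\<dots> \<le> (F ?z - \<eta> * (\<Sum>j<d. grad d F ?z j * grad d F x j)) + L * \<eta>\<^sup>2 / 2 * (G x + V / real P)"
    using L by (intro add_left_mono mult_left_mono expectation_mean_sgrad_sq x) simp
  also have "\<dots> \<le> F ?z - \<eta> / 4 * G x + L * \<eta>\<^sup>2 * V / (2 * real P)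
      + \<eta> * L\<^sup>2 / 2 * (\<Sum>j<d. (worker_mean P m j)\<^sup>2)"
  proof -
    have "(\<Sum>j<d. (grad d F ?z j - grad d F x j)\<^sup>2) \<le> (L * enorm d (\<lambda>j. ?z j - x j))\<^sup>2"
      unfolding enorm_sq[symmetric]
      using smooth x z unfolding smooth_Rd_def by (intro power_mono) auto
    also have "\<dots> = L\<^sup>2 * (\<Sum>j<d. (worker_mean P m j)\<^sup>2)"
      by (simp add: power_mult_distrib enorm_sq virtual_def power_divide)
    finally have dev: "(\<Sum>j<d. (grad d F ?z j - grad d F x j)\<^sup>2) \<le> L\<^sup>2 * (\<Sum>j<d. (worker_mean P m j)\<^sup>2)" .
    \<comment> \<open>Polarization: twice the product is the sum of both squares minus the squared
      difference; the square of the gradient at \<open>?z\<close> is dropped.\<close>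
    have "(\<Sum>j<d. (grad d F x j)\<^sup>2 - (grad d F ?z j - grad d F x j)\<^sup>2) \<le> (\<Sum>j<d. 2 * (grad d F ?z j * grad d F x j))"
    proof (intro sum_mono)
      fix j
      show "(grad d F x j)\<^sup>2 - (grad d F ?z j - grad d F x j)\<^sup>2 \<le> 2 * (grad d F ?z j * grad d F x j)"
        using zero_le_power2[of "grad d F ?z j"] by (simp add: power2_diff)
    qed
    with dev have "G x - L\<^sup>2 * (\<Sum>j<d. (worker_mean P m j)\<^sup>2) \<le> 2 * (\<Sum>j<d. grad d F ?z j * grad d F x j)"
      unfolding sum_subtractf sum_distrib_left[symmetric] by linarith
    then have 1: "\<eta> / 2 * (G x - L\<^sup>2 * (\<Sum>j<d. (worker_mean P m j)\<^sup>2))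
        \<le> \<eta> / 2 * (2 * (\<Sum>j<d. grad d F ?z j * grad d F x j))"
      using \<eta> by (intro mult_left_mono) auto
    \<comment> \<open>The decrease available is \<open>\<eta> / 2 * G x\<close>; half of it absorbs
      the second-order term.\<close>
    have "(\<eta> * L) * (\<eta> / 2 * G x) \<le> 1 / 2 * (\<eta> / 2 * G x)"
      using \<eta> by (intro mult_right_mono mult_nonneg_nonneg sum_nonneg) auto
    then have "L * \<eta>\<^sup>2 / 2 * G x \<le> \<eta> / 4 * G x"
      by (simp add: power2_eq_square mult_ac)
    with 1 show ?thesis
      by (simp add: right_diff_distrib distrib_left mult_ac)
  qed
  finally show ?thesis .
qed

text \<open>The weight of the memories is chosen so that their decrease by the fraction \<gamma>
  exactly offsets the error \<open>\<eta> * L\<^sup>2 / 2 * (memory m / real P)\<close> of the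
  virtual step.\<close>

definition potential :: "vec \<Rightarrow> (nat \<Rightarrow> vec) \<Rightarrow> real" where
  "potential x m = F (virtual x m) + \<eta> * L\<^sup>2 / (2 * \<gamma> * real P) * memory m"

text \<open>The first summand comes from the variance of the averaged gradient, the second from
  compressing noisy gradients, weighted as in the potential.\<close>

definition noise :: real where
  "noise = L * \<eta>\<^sup>2 * V / (2 * real P) + \<eta> ^ 3 * L\<^sup>2 * (real d / real k) * V / (\<gamma> * real P)"

text \<open>The defect can have either sign in an individual state. It is carried along unestimated,
  because its expectation over the run is zero.\<close>

lemma expectation_potential_step:
  assumes adm: "admissible x m"
  shows "measure_pmf.expectation (step (x, m)) (\<lambda>(x, m). potential x m)
    \<le> potential x m - \<eta> / 8 * G x + noise + \<eta> * L\<^sup>2 / 2 * defect m"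
proof -
  have x: "x \<in> Rd d" using adm by (simp add: admissible_def)
  define A where "A = \<eta> * L\<^sup>2 / (2 * \<gamma> * real P)"
  define q where "q = real d / real k"
  have A: "A \<ge> 0" using \<gamma> \<eta> by (simp add: A_def)
  have "measure_pmf.expectation (step (x, m)) (\<lambda>(x, m). potential x m) =
      measure_pmf.expectation (step (x, m)) (\<lambda>(x, m). F (virtual x m)) +
      A * measure_pmf.expectation (step (x, m)) (\<lambda>(x, m). memory m)"
    unfolding potential_def A_def[symmetric] case_prod_unfold
    by (simp only: expectation_add_finite[OF finite_step] integral_mult_right_zero)
  also have "\<dots> \<le> (F (virtual x m) - \<eta> / 4 * G x + L * \<eta>\<^sup>2 * V / (2 * real P)
      + \<eta> * L\<^sup>2 / 2 * (defect m + memory m / real P))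
      + A * ((1 - \<gamma>) * memory m + 2 * \<eta>\<^sup>2 * q * (G x + V))"
    unfolding mean_memory_eq[symmetric] q_def
    using A by (intro add_mono mult_left_mono expectation_virtual_step expectation_memory_step adm x)
  also have "A * ((1 - \<gamma>) * memory m + 2 * \<eta>\<^sup>2 * q * (G x + V)) =
      A * memory m - \<eta> * L\<^sup>2 / 2 * (memory m / real P) + \<eta> * (\<eta>\<^sup>2 * L\<^sup>2 * q / (\<gamma> * real P)) * (G x + V)"
    using \<gamma> P by (simp add: A_def field_simps power2_eq_square)
  \<comment> \<open>By the last step-size condition, the compression noise takes
    \<open>\<eta> / 8\<close> of the available decrease \<open>\<eta> / 4\<close>.\<close>
  also have "\<eta> * (\<eta>\<^sup>2 * L\<^sup>2 * q / (\<gamma> * real P)) * (G x + V) \<le>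
      \<eta> / 8 * G x + \<eta> ^ 3 * L\<^sup>2 * q * V / (\<gamma> * real P)"
  proof -
    have "\<eta> * (\<eta>\<^sup>2 * L\<^sup>2 * q / (\<gamma> * real P)) * G x \<le> \<eta> * (1 / 8) * G x"
      using \<eta> unfolding q_def by (intro mult_right_mono mult_left_mono sum_nonneg) auto
    moreover have "\<eta> * (\<eta>\<^sup>2 * L\<^sup>2 * q / (\<gamma> * real P)) * V = \<eta> ^ 3 * L\<^sup>2 * q * V / (\<gamma> * real P)"
      by (simp add: power3_eq_cube power2_eq_square)
    ultimately show ?thesis unfolding distrib_left by linarith
  qed
  finally show ?thesis
    unfolding potential_def noise_def A_def[symmetric] q_def[symmetric] distrib_left by linarith
qed

section \<open>The whole run\<close>

abbreviation "run x0 \<equiv> ssgd_ef d N P k f \<gamma> (\<lambda>_. \<eta>) x0"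

lemma finite_run: "finite (set_pmf (run x0 t))"
  by (induction t) (simp_all add: finite_step)

lemma run_admissible:
  assumes "x0 \<in> Rd d" "(x, m) \<in> set_pmf (run x0 t)"
  shows "admissible x m"
  using assms(2)
proof (induction t arbitrary: x m)
  case 0
  then show ?case using assms(1) by (simp add: admissible_def topspace_Euclidean_space)
next
  case (Suc t)
  then obtain s where s: "s \<in> set_pmf (run x0 t)" "(x, m) \<in> set_pmf (step s)"
    by (auto simp only: ssgd_ef.simps set_bind_pmf)
  obtain x' m' where "s = (x', m')" by (cases s)
  then show ?case using s Suc.IH step_admissible by metis
qed

lemma expectation_run_Suc:
  "measure_pmf.expectation (run x0 (Suc t)) h =
    measure_pmf.expectation (run x0 t) (\<lambda>(x, m). measure_pmf.expectation (step (x, m)) h)"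
  for h :: "vec \<times> (nat \<Rightarrow> vec) \<Rightarrow> real"
  by (simp add: expectation_bind_finite finite_run finite_step case_prod_unfold)

text \<open>The memories start at zero, hence so does the defect, and each step only multiplies its
  expectation by a constant.\<close>

lemma expectation_defect_run:
  "measure_pmf.expectation (run x0 t) (\<lambda>(x, m). defect m) = 0"
proof (induction t)
  case 0
  then show ?case by (simp add: defect_def)
next
  case (Suc t)
  have "measure_pmf.expectation (run x0 (Suc t)) (\<lambda>(x, m). defect m) =
      (1 - \<gamma>)\<^sup>2 * measure_pmf.expectation (run x0 t) (\<lambda>(x, m). defect m)"
    unfolding expectation_run_Suc expectation_defect_step by (simp add: case_prod_unfold)
  then show ?case using Suc by simp
qed

text \<open>The one-step estimates telescope. At time zero the memories vanish, so the virtual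
  iterate is \<open>x0\<close> and the potential is \<open>F x0\<close>.\<close>

lemma expectation_potential_run:
  assumes x0: "x0 \<in> Rd d"
  shows "measure_pmf.expectation (run x0 T) (\<lambda>(x, m). potential x m) +
    \<eta> / 8 * (\<Sum>t<T. measure_pmf.expectation (run x0 t) (\<lambda>(x, m). G x)) \<le> F x0 + real T * noise"
proof (induction T)
  case 0
  then show ?case by (simp add: potential_def memory_def virtual_def)
next
  case (Suc T)
  have "measure_pmf.expectation (run x0 (Suc T)) (\<lambda>(x, m). potential x m) \<le>
      measure_pmf.expectation (run x0 T) (\<lambda>(x, m). potential x m - \<eta> / 8 * G x + noise + \<eta> * L\<^sup>2 / 2 * defect m)"
    unfolding expectation_run_Suc
    using run_admissible[OF x0] expectation_potential_step
    by (intro expectation_mono_finite finite_run) auto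
  also have "\<dots> = measure_pmf.expectation (run x0 T) (\<lambda>(x, m). potential x m)
      - \<eta> / 8 * measure_pmf.expectation (run x0 T) (\<lambda>(x, m). G x) + noise
      + \<eta> * L\<^sup>2 / 2 * measure_pmf.expectation (run x0 T) (\<lambda>(x, m). defect m)"
    unfolding case_prod_unfold
    by (simp only: expectation_add_finite[OF finite_run] expectation_diff_finite[OF finite_run]
        integral_mult_right_zero lebesgue_integral_const measure_pmf.prob_space scaleR_one)
  finally show ?case
    using Suc unfolding expectation_defect_run by (simp add: distrib_left distrib_right)
qed

lemma expectation_out:
  fixes h :: "vec \<Rightarrow> real"
  assumes "1 \<le> T"
  shows "measure_pmf.expectation (ssgd_ef_out d N P k f \<gamma> (\<lambda>_. \<eta>) x0 T) h =
    (\<Sum>t<T. measure_pmf.expectation (run x0 t) (\<lambda>(x, m). h x)) / real T"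
proof -
  have "measure_pmf.expectation (ssgd_ef_out d N P k f \<gamma> (\<lambda>_. \<eta>) x0 T) h =
      measure_pmf.expectation (pmf_of_set {1..T})
        (\<lambda>t. measure_pmf.expectation (map_pmf fst (run x0 (t - 1))) h)"
    unfolding ssgd_ef_out_def using assms
    by (intro expectation_bind_finite) (auto simp: finite_run)
  also have "\<dots> = (\<Sum>t=1..T. measure_pmf.expectation (run x0 (t - 1)) (\<lambda>(x, m). h x)) / real T"
    using assms by (simp add: integral_pmf_of_set case_prod_unfold)
  \<comment> \<open>The output is the iterate before step \<open>t\<close>, so the average runs over
    the iterates \<open>0\<close> to \<open>T - 1\<close>.\<close>
  also have "(\<Sum>t=1..T. measure_pmf.expectation (run x0 (t - 1)) (\<lambda>(x, m). h x)) =
      (\<Sum>t<T. measure_pmf.expectation (run x0 t) (\<lambda>(x, m). h x))"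
    by (rule sum.reindex_bij_witness[of _ Suc "\<lambda>t. t - 1"]) auto
  finally show ?thesis .
qed

theorem expectation_out_gradient_le:
  assumes x0: "x0 \<in> Rd d" and T: "1 \<le> T" and lb: "\<And>x. x \<in> Rd d \<Longrightarrow> Fmin \<le> F x"
  shows "measure_pmf.expectation (ssgd_ef_out d N P k f \<gamma> (\<lambda>_. \<eta>) x0 T) (\<lambda>x. (enorm d (grad d F x))\<^sup>2)
    \<le> 8 * (F x0 - Fmin) / (\<eta> * real T) + 4 * L * \<eta> * V / real P
      + 8 * \<eta>\<^sup>2 * L\<^sup>2 * (real d / real k) * V / (\<gamma> * real P)"
proof -
  let ?S = "\<Sum>t<T. measure_pmf.expectation (run x0 t) (\<lambda>(x, m). G x)"
  have mem: "memory m \<ge> 0" for m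
    unfolding memory_def by (intro mult_nonneg_nonneg sum_nonneg) auto
  have "measure_pmf.expectation (run x0 T) (\<lambda>_. Fmin)
      \<le> measure_pmf.expectation (run x0 T) (\<lambda>(x, m). potential x m)"
  proof (intro expectation_mono_finite finite_run)
    fix s assume s: "s \<in> set_pmf (run x0 T)"
    obtain x m where xm: "s = (x, m)" by (cases s)
    \<comment> \<open>The lower bound is applied at the virtual iterate, which need not be visited
      by the algorithm.\<close>
    then have "virtual x m \<in> Rd d"
      using run_admissible[OF x0] s by (intro virtual_mem) auto
    then have "Fmin \<le> F (virtual x m)" by (rule lb)
    also have "\<dots> \<le> potential x m"
      using \<eta> \<gamma> mem unfolding potential_def by simp
    finally show "Fmin \<le> (case s of (x, m) \<Rightarrow> potential x m)" by (simp add: xm)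
  qed
  then have "\<eta> / 8 * ?S \<le> (F x0 - Fmin) + real T * noise"
    using expectation_potential_run[OF x0, of T] by simp
  then have "8 / (\<eta> * real T) * (\<eta> / 8 * ?S) \<le> 8 / (\<eta> * real T) * ((F x0 - Fmin) + real T * noise)"
    using \<eta> by (intro mult_left_mono) auto
  also have "8 / (\<eta> * real T) * (\<eta> / 8 * ?S) = ?S / real T"
    using \<eta> by simp
  also have "8 / (\<eta> * real T) * ((F x0 - Fmin) + real T * noise) = 8 * (F x0 - Fmin) / (\<eta> * real T) + 8 * noise / \<eta>"
    using \<eta> T by (simp add: field_simps)
  also have "8 * noise / \<eta> = 4 * L * \<eta> * V / real P
      + 8 * \<eta>\<^sup>2 * L\<^sup>2 * (real d / real k) * V / (\<gamma> * real P)"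
    using \<eta> by (simp add: noise_def add_divide_distrib distrib_left power3_eq_cube power2_eq_square mult_ac)
  finally show ?thesis
    unfolding expectation_out[OF T] enorm_sq by (simp add: add.assoc)
qed

end

section \<open>Choice of the step size and the iteration count\<close>

lemma bounded_variance_nonneg:
  assumes "bounded_variance d N P V f" "x \<in> Rd d"
  shows "0 \<le> V"
proof -
  have "0 \<le> 1 / (real N * real P) * (\<Sum>i=1..N. \<Sum>p=1..P.
     (enorm d (\<lambda>j. grad d (f i p) x j - grad d (objective N P f) x j))\<^sup>2)"
    by (intro mult_nonneg_nonneg sum_nonneg) auto
  also have "\<dots> \<le> V" using assms unfolding bounded_variance_def by blast
  finally show ?thesis .
qed

text \<open>The inverse step size \<open>S\<close> is a sum, rather than a maximum, of the four required lower bounds;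
  this also covers \<open>V = 0\<close>.\<close>

lemma step_size_budget:
  fixes L V q c \<epsilon> \<Delta> P :: real
  assumes pos: "0 < L" "0 \<le> V" "1 \<le> q" "0 < c" "0 < \<epsilon>" "0 \<le> \<Delta>" "1 \<le> P"
  defines "r \<equiv> sqrt (32 / c)"
  defines "S \<equiv> 2 * L + 16 * L * V / (\<epsilon> * P) + L * q * r / sqrt P
    + L * q * r * sqrt V / (sqrt \<epsilon> * sqrt P)"
  defines "\<eta> \<equiv> 1 / S"
  defines "T \<equiv> nat \<lceil>16 * \<Delta> * S / \<epsilon>\<rceil> + 1"
  shows "0 < \<eta>" and "\<eta> * L \<le> 1 / 2"
    and "\<eta>\<^sup>2 * L\<^sup>2 * q / (c / q * P) \<le> 1 / 8"
    and "8 * \<Delta> / (\<eta> * real T) + 4 * L * \<eta> * V / P + 8 * \<eta>\<^sup>2 * L\<^sup>2 * q * V / (c / q * P) \<le> \<epsilon>"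
    and "real T \<le> (258 + 16 * r) * (L * \<Delta> / \<epsilon> + V / P * (L * \<Delta> / \<epsilon>\<^sup>2) + q
      + q / sqrt P * (L * \<Delta> / \<epsilon> + L * sqrt V * \<Delta> / \<epsilon> powr (3 / 2)))"
proof -
  have r: "r > 0" and r2: "r\<^sup>2 = 32 / c" using pos by (simp_all add: r_def)
  \<comment> \<open>With \<open>\<eta> = 1 / S\<close>, each summand of \<open>S\<close> bounds one
    quantity: \<open>2 * L\<close> gives the descent condition, \<open>t3\<close> the smallness
    condition, and \<open>t2\<close> and \<open>t4\<close> bring the two noise terms below
    \<open>\<epsilon> / 4\<close> each. The remaining \<open>\<epsilon> / 2\<close> is for the
    initial gap.\<close>
  define t2 where "t2 = 16 * L * V / (\<epsilon> * P)"
  define t3 where "t3 = L * q * r / sqrt P"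
  define t4 where "t4 = L * q * r * sqrt V / (sqrt \<epsilon> * sqrt P)"
  have t: "0 \<le> t2" "0 \<le> t3" "0 \<le> t4"
    using pos r by (auto simp: t2_def t3_def t4_def)
  have S: "S = 2 * L + t2 + t3 + t4" by (simp add: S_def t2_def t3_def t4_def)
  have S0: "S > 0" using t pos by (simp add: S)
  show \<eta>: "0 < \<eta>" using S0 by (simp add: \<eta>_def)
  have le1: "\<eta> * u \<le> 1" if "u \<le> S" for u
    using that S0 by (simp add: \<eta>_def)
  have sq1: "(\<eta> * u)\<^sup>2 \<le> 1" if "u \<le> S" "0 \<le> u" for u
    using le1[OF that(1)] that(2) \<eta> by (simp add: abs_square_le_1 abs_mult)
  have "\<eta> * (2 * L) \<le> 1" using t by (intro le1) (simp add: S)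
  then show "\<eta> * L \<le> 1 / 2" by simp
  \<comment> \<open>\<open>K\<close> is both the left side of the smallness condition and, times
    \<open>8 * V\<close>, the compression noise. The choice of \<open>r\<close> makes the square of
    \<open>\<eta> * t3\<close> equal to \<open>32 * K\<close>.\<close>
  define K where "K = \<eta>\<^sup>2 * L\<^sup>2 * q\<^sup>2 / (c * P)"
  have K: "\<eta>\<^sup>2 * L\<^sup>2 * q / (c / q * P) = K"
    using pos by (simp add: K_def power2_eq_square field_simps)
  have "(\<eta> * t3)\<^sup>2 \<le> 1" using t pos by (intro sq1) (auto simp: S)
  moreover have "(\<eta> * t3)\<^sup>2 = 32 * K"
    using pos by (simp add: t3_def K_def power_mult_distrib power_divide r2)
  ultimately show "\<eta>\<^sup>2 * L\<^sup>2 * q / (c / q * P) \<le> 1 / 8"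
    unfolding K by simp
  have "(\<eta> * t4)\<^sup>2 \<le> 1" using t pos by (intro sq1) (auto simp: S)
  moreover have "(\<eta> * t4)\<^sup>2 = 32 * K * V / \<epsilon>"
    using pos by (simp add: t4_def K_def power_mult_distrib power_divide r2 mult_ac)
  ultimately have KV: "32 * K * V \<le> \<epsilon>"
    using pos by (simp add: pos_divide_le_eq)
  have "\<eta> * t2 \<le> 1" using t pos by (intro le1) (simp add: S)
  moreover have "\<eta> * t2 = 4 * (4 * L * \<eta> * V / P) / \<epsilon>"
    using pos by (simp add: t2_def mult_ac)
  ultimately have LV: "4 * (4 * L * \<eta> * V / P) \<le> \<epsilon>"
    using pos by (simp only: pos_divide_le_eq mult_1)
  \<comment> \<open>The added \<open>1\<close> makes \<open>T\<close> positive even when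
    \<open>\<Delta> = 0\<close>; with the rounding it costs at most \<open>2\<close>.\<close>
  have T: "16 * \<Delta> * S / \<epsilon> \<le> real T" "real T \<le> 16 * \<Delta> * S / \<epsilon> + 2" "0 < real T"
  proof -
    have "0 \<le> 16 * \<Delta> * S / \<epsilon>" using pos S0 by simp
    then show "16 * \<Delta> * S / \<epsilon> \<le> real T" "real T \<le> 16 * \<Delta> * S / \<epsilon> + 2" "0 < real T"
      unfolding T_def by linarith+
  qed
  have "8 * \<Delta> / (\<eta> * real T) = 8 * \<Delta> * S / real T" by (simp add: \<eta>_def)
  also have "\<dots> \<le> \<epsilon> / 2"
    using T(1,3) pos by (simp add: field_simps)
  finally have "8 * \<Delta> / (\<eta> * real T) \<le> \<epsilon> / 2" .
  moreover have "8 * \<eta>\<^sup>2 * L\<^sup>2 * q * V / (c / q * P) = 8 * K * V"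
    unfolding K[symmetric] by simp
  ultimately show "8 * \<Delta> / (\<eta> * real T) + 4 * L * \<eta> * V / P + 8 * \<eta>\<^sup>2 * L\<^sup>2 * q * V / (c / q * P) \<le> \<epsilon>"
    using KV LV by linarith
  define a1 where "a1 = L * \<Delta> / \<epsilon>"
  define a2 where "a2 = V / P * (L * \<Delta> / \<epsilon>\<^sup>2)"
  define a3 where "a3 = q / sqrt P * (L * \<Delta> / \<epsilon>)"
  define a4 where "a4 = q / sqrt P * (L * sqrt V * \<Delta> / \<epsilon> powr (3 / 2))"
  have a: "0 \<le> a1" "0 \<le> a2" "0 \<le> a3" "0 \<le> a4"
    using pos by (auto simp: a1_def a2_def a3_def a4_def)
  have powr: "\<epsilon> powr (3 / 2) = \<epsilon> * sqrt \<epsilon>"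
    using pos powr_add[of \<epsilon> 1 "1 / 2"] by (simp add: powr_half_sqrt)
  \<comment> \<open>The four summands of \<open>S\<close>, in order, produce the four
    \<Delta>-dependent terms of the complexity. The rounding loss \<open>2\<close> is then at most
    \<open>2 * q\<close> and goes into the term \<open>d / k\<close>.\<close>
  have "16 * \<Delta> * S / \<epsilon> = 32 * a1 + 256 * a2 + 16 * r * a3 + 16 * r * a4"
    unfolding S t2_def t3_def t4_def a1_def a2_def a3_def a4_def powr
    by (simp add: distrib_left add_divide_distrib power2_eq_square mult_ac)
  then have "real T \<le> 32 * a1 + 256 * a2 + 2 * q + 16 * r * a3 + 16 * r * a4"
    using T(2) pos by linarith
  \<comment> \<open>One constant dominates all the coefficients \<open>32\<close>,
    \<open>256\<close>, \<open>2\<close> and \<open>16 * r\<close>.\<close>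
  also have "\<dots> \<le> (258 + 16 * r) * a1 + (258 + 16 * r) * a2 + (258 + 16 * r) * q
      + (258 + 16 * r) * a3 + (258 + 16 * r) * a4"
    using a r pos by (intro add_mono mult_right_mono) auto
  finally show "real T \<le> (258 + 16 * r) * (L * \<Delta> / \<epsilon> + V / P * (L * \<Delta> / \<epsilon>\<^sup>2) + q
      + q / sqrt P * (L * \<Delta> / \<epsilon> + L * sqrt V * \<Delta> / \<epsilon> powr (3 / 2)))"
    unfolding distrib_left a1_def a2_def a3_def a4_def by (simp add: add.assoc)
qed

lemma ssgd_ef_complexity:
  fixes d N P k :: nat and f :: "nat \<Rightarrow> nat \<Rightarrow> vec \<Rightarrow> real" and c L V \<epsilon> :: real and xin xstar :: vec
  assumes c: "0 < c" "c \<le> 1 / 3"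
    and N: "1 \<le> N" and P: "1 \<le> P" and k: "1 \<le> k" "k \<le> d" and L: "0 < L"
    and diff: "\<forall>i\<in>{1..N}. \<forall>p\<in>{1..P}. differentiable_Rd d (f i p)"
    and smooth: "smooth_Rd d L (objective N P f)" and var: "bounded_variance d N P V f"
    and xin: "xin \<in> Rd d"
    and min: "\<forall>x\<in>Rd d. objective N P f xstar \<le> objective N P f x" and \<epsilon>: "0 < \<epsilon>"
  shows "let \<Delta> = objective N P f xin - objective N P f xstar;
         \<gamma> = c * real k / real d
     in \<exists>\<eta>>0. \<exists>T::nat. 1 \<le> T \<and>
          real T \<le> (258 + 16 * sqrt (32 / c)) * (L * \<Delta> / \<epsilon> + V / real P * (L * \<Delta> / \<epsilon>\<^sup>2) + real d / real k
              + real d / (real k * sqrt (real P)) *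
                  (L * \<Delta> / \<epsilon> + L * sqrt V * \<Delta> / \<epsilon> powr (3 / 2))) \<and>
          measure_pmf.expectation (ssgd_ef_out d N P k f \<gamma> (\<lambda>_. \<eta>) xin T)
            (\<lambda>x. (enorm d (grad d (objective N P f) x))\<^sup>2) \<le> \<epsilon>"
proof -
  define q where "q = real d / real k"
  define \<Delta> where "\<Delta> = objective N P f xin - objective N P f xstar"
  have q: "1 \<le> q" using k by (simp add: q_def)
  have \<Delta>: "0 \<le> \<Delta>" using min xin by (simp add: \<Delta>_def)
  have gamma_eq: "c * real k / real d = c / q" by (simp add: q_def)
  have V: "0 \<le> V" using var xin by (rule bounded_variance_nonneg)
  have P': "1 \<le> real P" using P by simp
  define r where "r = sqrt (32 / c)"
  define S where "S = 2 * L + 16 * L * V / (\<epsilon> * real P) + L * q * r / sqrt (real P)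
    + L * q * r * sqrt V / (sqrt \<epsilon> * sqrt (real P))"
  define T where "T = nat \<lceil>16 * \<Delta> * S / \<epsilon>\<rceil> + 1"
  note budget = step_size_budget[OF L V q c(1) \<epsilon> \<Delta> P',
      folded r_def, folded S_def, folded T_def]
  \<comment> \<open>Since \<open>q \<ge> 1\<close>, the left side of the locale's condition on
    \<gamma> is at most \<open>c + 2 * c\<close>, whence the threshold \<open>1 / 3\<close> for
    \<open>c\<close>.\<close>
  have "c / q \<le> c" using c q by (simp add: pos_divide_le_eq)
  then have sum: "c / q + 2 * q * (c / q) \<le> 1" using c q by simp
  interpret ssgd_ef_setting d N P k f L V "c / q" "1 / S"
    using N P k L diff smooth var budget(1-3) sum c q
    by unfold_locales (auto simp: q_def[symmetric])
  have "measure_pmf.expectation (ssgd_ef_out d N P k f (c / q) (\<lambda>_. 1 / S) xin T)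
      (\<lambda>x. (enorm d (grad d (objective N P f) x))\<^sup>2) \<le>
      8 * \<Delta> / (1 / S * real T) + 4 * L * (1 / S) * V / real P + 8 * (1 / S)\<^sup>2 * L\<^sup>2 * q * V / (c / q * real P)"
    unfolding \<Delta>_def q_def
    using min xin by (intro expectation_out_gradient_le[unfolded q_def]) (auto simp: T_def)
  also have "\<dots> \<le> \<epsilon>" by (rule budget(4))
  finally have out: "measure_pmf.expectation (ssgd_ef_out d N P k f (c / q) (\<lambda>_. 1 / S) xin T)
      (\<lambda>x. (enorm d (grad d (objective N P f) x))\<^sup>2) \<le> \<epsilon>" .
  have qP: "real d / (real k * sqrt (real P)) = q / sqrt (real P)" by (simp add: q_def)
  have T: "1 \<le> T" by (simp add: T_def)
  show ?thesis
    unfolding Let_def gamma_eq qP q_def[symmetric] r_def[symmetric] \<Delta>_def[symmetric]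
    using budget(1,5) out T by blast
qed

text \<open>The constant \<open>C\<close> may depend on \<open>c\<close>, but is chosen before the
  dimension, the functions and all other parameters. The witness grows like the inverse square root
  of \<open>c\<close> as \<open>c\<close> tends to zero.\<close>

theorem theoremA11:
  shows "\<exists>c0>0. \<forall>c::real. 0 < c \<and> c \<le> c0 \<longrightarrow> (\<exists>C>0.
    \<forall>(d::nat) (N::nat) (P::nat) (k::nat) (f :: nat \<Rightarrow> nat \<Rightarrow> vec \<Rightarrow> real) (L::real) (V::real)
      (xin::vec) (xstar::vec) (\<epsilon>::real).
      1 \<le> d \<longrightarrow> 1 \<le> N \<longrightarrow> 1 \<le> P \<longrightarrow> 1 \<le> k \<longrightarrow> k \<le> d \<longrightarrow> 0 < L \<longrightarrow>
      (\<forall>i\<in>{1..N}. \<forall>p\<in>{1..P}. differentiable_Rd d (f i p)) \<longrightarrow>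
      smooth_Rd d L (objective N P f) \<longrightarrow>
      bounded_variance d N P V f \<longrightarrow>
      xin \<in> Rd d \<longrightarrow>
      xstar \<in> Rd d \<longrightarrow> (\<forall>x\<in>Rd d. objective N P f xstar \<le> objective N P f x) \<longrightarrow>
      0 < \<epsilon> \<longrightarrow>
      (let \<Delta> = objective N P f xin - objective N P f xstar;
           \<gamma> = c * real k / real d
       in \<exists>\<eta>>0. \<exists>T::nat. 1 \<le> T \<and>
            real T \<le> C * (L * \<Delta> / \<epsilon> + V / real P * (L * \<Delta> / \<epsilon>\<^sup>2) + real d / real k
                + real d / (real k * sqrt (real P)) *
                    (L * \<Delta> / \<epsilon> + L * sqrt V * \<Delta> / \<epsilon> powr (3 / 2))) \<and>
            measure_pmf.expectation (ssgd_ef_out d N P k f \<gamma> (\<lambda>_. \<eta>) xin T)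
              (\<lambda>x. (enorm d (grad d (objective N P f) x))\<^sup>2) \<le> \<epsilon>))"
proof (rule exI[of _ "1 / 3"], intro conjI allI impI, goal_cases)
  case (2 c)
  then show ?case
    by (intro exI[of _ "258 + 16 * sqrt (32 / c)"] conjI allI impI ssgd_ef_complexity)
      (auto intro: add_pos_nonneg)
qed simp

end
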